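(* Let $\alpha>1/2$, $\boldsymbol\gamma=(\gamma_1,\gamma_2,\ldots)\in[0,1]^{\mathbb N}$ and $\tau\in(0,1)$. Consider pairs $(M,s)$ of positive integers with $M\ge2$ satisfying $$M\ \ge\ \inf_{1/2\le\lambda'<\alpha}\ \frac{2}{1-\tau}\sum_{\emptyset\ne u\subseteq\{1,\ldots,s\}}\gamma_u^{1/\lambda'}\bigl(2\zeta(\alpha/\lambda')\bigr)^{|u|}.\qquad( * )$$ (i) If $1/2<\lambda<\alpha$ is such that $\sum_{j=1}^\infty\gamma_j^{1/\lambda}<\infty$, then for every $0<\delta<\min(\lambda-1/2,1)$ there is a constant $C>0$, independent of $s$ and $M$, such that $e^{\mathrm{rand}}(H_{s,\alpha,\boldsymbol\gamma},A_{M,\tau})\le C\,M^{-(\lambda+1/2-\delta)}$ for all $(M,s)$ satisfying $( * )$. (ii) In particular, if $\sum_{j=1}^\infty\gamma_j^{1/\alpha}<\infty$, then for every $\varepsilon>0$ there is a constant $C>0$, independent of $s$ and $M$, such that $e^{\mathrm{rand}}(H_{s,\alpha,\boldsymbol\gamma},A_{M,\tau})\le C\,M^{-(\alpha+1/2)+\varepsilon}$ for all $(M,s)$ satisfying $( * )$.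
   Context: Notation: $\mathbb N=\{1,2,\ldots\}$; $\zeta$ is the Riemann zeta function; $\gamma_u=\prod_{j\in u}\gamma_j$. $I(f)=\int_{[0,1)^s}f(\boldsymbol x)\,d\boldsymbol x$, and for a finite point (multi)set $P$ with $N$ elements, $I(f;P)=\frac1N\sum_{\boldsymbol x\in P}f(\boldsymbol x)$. Weighted Korobov space. For $\boldsymbol k\in\mathbb Z^{\ell}$ put $r_{\alpha,\boldsymbol\gamma}(\boldsymbol k)=\prod_{j:\,k_j\ne0}|k_j|^\alpha/\gamma_j$ (empty product $=1$; if $k_j\neq 0$ and $\gamma_j=0$ for some $j$, then $1/r_{\alpha,\boldsymbol\gamma}(\boldsymbol k)=0$). $H_{s,\alpha,\boldsymbol\gamma}$ is the space of functions $f:[0,1)^s\to\mathbb R$ (one-periodic in each variable) with absolutely convergent Fourier series $f(\boldsymbol x)=\sum_{\boldsymbol k\in\mathbb Z^s}\hat f(\boldsymbol k)e^{2\pi i\boldsymbol k\cdot\boldsymbol x}$ and finite norm $\|f\|_{s,\alpha,\boldsymbol\gamma}=\bigl(\sum_{\boldsymbol k\in\mathbb Z^s}r_{\alpha,\boldsymbol\gamma}(\boldsymbol k)^2|\hat f(\boldsymbol k)|^2\bigr)^{1/2}$; if $\gamma_j=0$, it is required that $\hat f(\boldsymbol k)=0$ whenever $k_j\ne0$ (and such terms contribute $0$ to the norm). Lattice rules. For $N\ge2$ and $\boldsymbol z\in\{1,\ldots,N-1\}^{\ell}$, the rank-1 lattice point set is $P_{N,\boldsymbol z}=\{\{n\boldsymbol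 z/N\}:n=0,\ldots,N-1\}$ (componentwise fractional parts), and its dual lattice is $P_{N,\boldsymbol z}^\perp=\{\boldsymbol k\in\mathbb Z^{\ell}:\boldsymbol k\cdot\boldsymbol z\equiv0\pmod N\}$. Let $R_{\alpha,\boldsymbol\gamma}(\boldsymbol z)=\sum_{\boldsymbol k\in P_{N,\boldsymbol z}^\perp\setminus\{\boldsymbol 0\}}r_{\alpha,\boldsymbol\gamma}(\boldsymbol k)^{-2}$. Randomized component-by-component algorithm. Let $\mathbb P_M=\{N \text{ prime}:\lceil M/2\rceil<N\le M\}$. (1) Pick $N\in\mathbb P_M$ uniformly at random. (2) Set $z_1=1$. (3) For $\ell=2,\ldots,s$, given $\boldsymbol z_{\ell-1}=(z_1,\ldots,z_{\ell-1})$, let $Z_\ell\subset\{1,\ldots,N-1\}$ consist of the $\lceil\tau(N-1)\rceil$ elements $\zeta$ with the smallest values of $R_{\alpha,\boldsymbol\gamma}(\boldsymbol z_{\ell-1},\zeta)$ (ties broken in favour of the smaller integer), and pick $z_\ell\in Z_\ell$ uniformly at random. For $N\in\mathbb P_M$, $\mathcal Z_{N,\tau}\subseteq\{1,\ldots,N-1\}^s$ denotes the set of all vectors $\boldsymbol z=(z_1,\ldots,z_s)$ that steps (2)–(3) can produce. The randomized algorithm is $A_{M,\tau}(f)=I(f;P_{N,\boldsymbol z})$ with $N$ uniform in $\mathbb P_M$ and $\boldsymbol z$ uniform in $\mathcal Z_{N,\tau}$, and its randomized error is $$e^{\mathrm{rand}}(H_{s,\alpha,\boldsymbol\gamma},A_{M,\tau})=\sup_{\|f\|_{s,\alpha,\boldsymbol\gamma}\le1}\frac1{|\mathbb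 P_M|}\sum_{N\in\mathbb P_M}\frac1{|\mathcal Z_{N,\tau}|}\sum_{\boldsymbol z\in\mathcal Z_{N,\tau}}|I(f;P_{N,\boldsymbol z})-I(f)|.$$ *)

theory Defs
  imports "HOL-Analysis.Analysis" "HOL-Number_Theory.Cong"
begin

(* Vectors with l coordinates are extensional functions on {1..l}, so that the dimension is an
   ordinary natural number and the functions live on the space of the product measure PiM.
   Weights are sequences nat => real of which only the entries with index >= 1 are used. *)

definition int_vecs :: "nat \<Rightarrow> (nat \<Rightarrow> int) set"
  where "int_vecs l = {1..l} \<rightarrow>\<^sub>E UNIV"

definition zero_vec :: "nat \<Rightarrow> nat \<Rightarrow> int"
  where "zero_vec l = (\<lambda>j\<in>{1..l}. 0)"

definition unit_cube :: "nat \<Rightarrow> (nat \<Rightarrow> real) set"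
  where "unit_cube s = {1..s} \<rightarrow>\<^sub>E {0..<1}"

abbreviation lborel_vec :: "nat \<Rightarrow> (nat \<Rightarrow> real) measure"
  where "lborel_vec s \<equiv> PiM {1..s} (\<lambda>_. lborel)"

definition cube_integral :: "nat \<Rightarrow> ((nat \<Rightarrow> real) \<Rightarrow> real) \<Rightarrow> real"
  where "cube_integral s f = (LINT x:unit_cube s|lborel_vec s. f x)"

definition real_zeta :: "real \<Rightarrow> real"
  where "real_zeta x = (\<Sum>n. 1 / real (Suc n) powr x)"

(* If k j \<noteq> 0 and \<gamma> j = 0 for some j, then the value is 0 by division by zero.  Hence 1 / korobov_r is 0
   and a factor korobov_r^2 annihilates the corresponding term of the norm, as the conventions
   for vanishing weights demand. *)
definition korobov_r :: "real \<Rightarrow> (nat \<Rightarrow> real) \<Rightarrow> nat \<Rightarrow> (nat \<Rightarrow> int) \<Rightarrow> real"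
  where "korobov_r \<alpha> \<gamma> l k = (\<Prod>j\<in>{j\<in>{1..l}. k j \<noteq> 0}. \<bar>real_of_int (k j)\<bar> powr \<alpha> / \<gamma> j)"

definition fourier_char :: "nat \<Rightarrow> (nat \<Rightarrow> int) \<Rightarrow> (nat \<Rightarrow> real) \<Rightarrow> complex"
  where "fourier_char s k x = cis (2 * pi * (\<Sum>j=1..s. real_of_int (k j) * x j))"

definition fourier_coeff :: "nat \<Rightarrow> ((nat \<Rightarrow> real) \<Rightarrow> real) \<Rightarrow> (nat \<Rightarrow> int) \<Rightarrow> complex"
  where "fourier_coeff s f k =
    (LINT x:unit_cube s|lborel_vec s. complex_of_real (f x) * cnj (fourier_char s k x))"

definition korobov_norm :: "nat \<Rightarrow> real \<Rightarrow> (nat \<Rightarrow> real) \<Rightarrow> ((nat \<Rightarrow> real) \<Rightarrow> real) \<Rightarrow> real"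
  where "korobov_norm s \<alpha> \<gamma> f =
    sqrt (\<Sum>\<^sub>\<infinity>k\<in>int_vecs s. (korobov_r \<alpha> \<gamma> s k)\<^sup>2 * (norm (fourier_coeff s f k))\<^sup>2)"

(* Only the values of f on unit_cube s matter here and below; f stands for the one-periodic
   extension of these values. *)
definition korobov_space :: "nat \<Rightarrow> real \<Rightarrow> (nat \<Rightarrow> real) \<Rightarrow> ((nat \<Rightarrow> real) \<Rightarrow> real) set"
  where "korobov_space s \<alpha> \<gamma> = {f.
    (\<lambda>k. norm (fourier_coeff s f k)) summable_on int_vecs s \<and>
    (\<forall>x\<in>unit_cube s.
       ((\<lambda>k. fourier_coeff s f k * fourier_char s k x) has_sum complex_of_real (f x)) (int_vecs s)) \<and>
    (\<lambda>k. (korobov_r \<alpha> \<gamma> s k)\<^sup>2 * (norm (fourier_coeff s f k))\<^sup>2) summable_on int_vecs s \<and>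
    (\<forall>k\<in>int_vecs s. (\<exists>j\<in>{1..s}. \<gamma> j = 0 \<and> k j \<noteq> 0) \<longrightarrow> fourier_coeff s f k = 0)}"

definition lattice_point :: "nat \<Rightarrow> nat \<Rightarrow> (nat \<Rightarrow> nat) \<Rightarrow> nat \<Rightarrow> nat \<Rightarrow> real"
  where "lattice_point s N z n = (\<lambda>j\<in>{1..s}. frac (real n * real (z j) / real N))"

definition lattice_rule :: "nat \<Rightarrow> nat \<Rightarrow> (nat \<Rightarrow> nat) \<Rightarrow> ((nat \<Rightarrow> real) \<Rightarrow> real) \<Rightarrow> real"
  where "lattice_rule s N z f = (1 / real N) * (\<Sum>n<N. f (lattice_point s N z n))"

definition dual_lattice :: "nat \<Rightarrow> nat \<Rightarrow> (nat \<Rightarrow> nat) \<Rightarrow> (nat \<Rightarrow> int) set"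
  where "dual_lattice l N z = {k \<in> int_vecs l. [(\<Sum>j=1..l. k j * int (z j)) = 0] (mod int N)}"

definition korobov_R :: "real \<Rightarrow> (nat \<Rightarrow> real) \<Rightarrow> nat \<Rightarrow> nat \<Rightarrow> (nat \<Rightarrow> nat) \<Rightarrow> real"
  where "korobov_R \<alpha> \<gamma> l N z = (\<Sum>\<^sub>\<infinity>k\<in>dual_lattice l N z - {zero_vec l}. 1 / (korobov_r \<alpha> \<gamma> l k)\<^sup>2)"

definition primes_half_upto :: "nat \<Rightarrow> nat set"
  where "primes_half_upto M = {N. prime N \<and> \<lceil>real M / 2\<rceil> < int N \<and> N \<le> M}"

(* The candidates for component l, given the components of z with index < l.  As sort_key is
   stable and the list [1..<N] is increasing, ties are broken in favour of the smaller integer. *)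
definition cbc_choices ::
    "real \<Rightarrow> (nat \<Rightarrow> real) \<Rightarrow> real \<Rightarrow> nat \<Rightarrow> nat \<Rightarrow> (nat \<Rightarrow> nat) \<Rightarrow> nat set"
  where "cbc_choices \<alpha> \<gamma> \<tau> N l z =
    set (take (nat \<lceil>\<tau> * real (N - 1)\<rceil>) (sort_key (\<lambda>c. korobov_R \<alpha> \<gamma> l N (z(l := c))) [1..<N]))"

definition cbc_vectors :: "real \<Rightarrow> (nat \<Rightarrow> real) \<Rightarrow> real \<Rightarrow> nat \<Rightarrow> nat \<Rightarrow> (nat \<Rightarrow> nat) set"
  where "cbc_vectors \<alpha> \<gamma> \<tau> s N = {z \<in> {1..s} \<rightarrow>\<^sub>E {1..N - 1}.
    z 1 = 1 \<and> (\<forall>l\<in>{2..s}. z l \<in> cbc_choices \<alpha> \<gamma> \<tau> N l (restrict z {1..l - 1}))}"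

definition rand_error :: "real \<Rightarrow> (nat \<Rightarrow> real) \<Rightarrow> real \<Rightarrow> nat \<Rightarrow> nat \<Rightarrow> ereal"
  where "rand_error \<alpha> \<gamma> \<tau> s M =
    (SUP f\<in>{f \<in> korobov_space s \<alpha> \<gamma>. korobov_norm s \<alpha> \<gamma> f \<le> 1}.
       ereal ((1 / real (card (primes_half_upto M))) *
         (\<Sum>N\<in>primes_half_upto M. (1 / real (card (cbc_vectors \<alpha> \<gamma> \<tau> s N))) *
           (\<Sum>z\<in>cbc_vectors \<alpha> \<gamma> \<tau> s N. \<bar>lattice_rule s N z f - cube_integral s f\<bar>))))"

definition admissible :: "real \<Rightarrow> (nat \<Rightarrow> real) \<Rightarrow> real \<Rightarrow> nat \<Rightarrow> nat \<Rightarrow> bool"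
  where "admissible \<alpha> \<gamma> \<tau> M s \<longleftrightarrow> M \<ge> 2 \<and> s \<ge> 1 \<and>
    real M \<ge> (INF q\<in>{1/2..<\<alpha>}. 2 / (1 - \<tau>) *
      (\<Sum>u\<in>Pow {1..s} - {{}}. (\<Prod>j\<in>u. \<gamma> j) powr (1 / q) * (2 * real_zeta (\<alpha> / q)) ^ card u))"

end

(* For f = sum f^(k) e(k.x) the error of a lattice rule is the sum of f^(k) over the nonzero dual
   lattice, so the averaged error is at most the sum of |f^(k)| P(k), where P(k) is the probability
   that k lies in the random dual lattice.  By Cauchy-Schwarz it suffices to bound the sum of
   r(k)^-2 P(k)^2.

   If N does not divide all k_j, then, with l the last index such that N does not divide k_l, at most
   one choice of z_l puts k into the dual lattice; and only log|k| primes N divide all k_j.  With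
   about M / log M available primes (Chebyshev) this gives P(k) <= C M^(-1+eps) unless r(k) exceeds
   a large power of M.  Such k contribute little, because sum r(k)^(-1/q) is bounded uniformly in s,
   and for the others
     sum r(k)^-2 P(k)^2 <= C M^(-1+eps) sum r(k)^-2 P(k) = C M^(-1+eps) (average of R(z)).
   Finally R(z) = O(M^(-2q)) for all candidate vectors: the increment of R in each component, raised
   to the power 1/(2q), is subadditive in the dual vectors, hence small on average over z_l, and the
   chosen z_l is at most (1-tau)^-1 times worse than the average (Markov).

   Chebyshev's bound for (n, 2n] is obtained as in Erdos's proof of Bertrand's postulate:
   ln C(2n,n) <= psi(2n) - psi(n) + psi(2n/3), and psi(n) <= n ln 4. *)
theory Submission
  imports Defs "HOL-Number_Theory.Prime_Powers" "HOL-Real_Asymp.Real_Asymp"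
begin

subsection \<open>Primes in dyadic intervals\<close>

text \<open>The two sources of randomness serve different frequencies. If N divides every k_j, then
  k lies in the dual lattice of every z, so for that N the choice of z cannot help; only the
  averaging over primes makes P(k) small. For all other k the choice of z alone gives a bound of
  order 1/M. The rate is the product of the bound M^(-1+2 eps) for P(k) and the bound M^(-2q) for
  the average of R; the square root turns this into M^(-q-1/2+eps). Both losses of eps come from
  replacing a logarithm by a power of M, once in the prime count and once in the bound for log r(k).
  The exponent 1/(2q) is confined from two sides: subadditivity of t^(1/(2q)) needs q >= 1/2, and
  the sum of |m|^(-alpha/q) over nonzero m, which then appears in each coordinate, needs q < alpha.
  Hence the limiting rate in (ii) is approached with q slightly below alpha.\<close>

definition psi :: "nat \<Rightarrow> real" where "psi n = (\<Sum>d=1..n. mangoldt d)"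

text \<open>Expand ln k as the sum of \<open>mangoldt d\<close> over the divisors d of k and count
  the multiples of d up to n. Terms with d > n vanish, so the range may end at any m >= n; this lets
  the three factorials of a binomial coefficient share one range.\<close>

lemma ln_fact_eq_sum_mangoldt:
  assumes "n \<le> m"
  shows "ln (fact n :: real) = (\<Sum>d=1..m. mangoldt d * real (n div d))"
proof -
  have eq: "{1..n} \<inter> {k. d dvd k} = (\<lambda>i. d * i) ` {1..n div d}" if "d \<ge> 1" for d
  proof (intro equalityI subsetI)
    fix k assume k: "k \<in> {1..n} \<inter> {k. d dvd k}"
    then obtain i where i: "k = d * i" by auto
    have "i = k div d" using i that by simp
    then have "i \<le> n div d" using k by (simp add: div_le_mono)
    moreover have "i \<ge> 1" using k i by (cases i) auto
    ultimately show "k \<in> (\<lambda>i. d * i) ` {1..n div d}" using i by auto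
  next
    fix k assume "k \<in> (\<lambda>i. d * i) ` {1..n div d}"
    then obtain i where i: "k = d * i" "i \<ge> 1" "i \<le> n div d" by (metis imageE atLeastAtMost_iff)
    have "d * i \<le> n" using mult_le_mono2[OF i(3), of d] times_div_less_eq_dividend[of d n] by linarith
    then show "k \<in> {1..n} \<inter> {k. d dvd k}" using i that by auto
  qed
  have "ln (fact n :: real) = (\<Sum>k=1..n. ln (real k))"
    by (subst fact_prod, subst of_nat_prod, subst ln_prod) auto
  also have "\<dots> = (\<Sum>k=1..n. \<Sum>d | d dvd k. mangoldt d)"
    using mangoldt_sum[where 'a = real] by (intro sum.cong) auto
  also have "\<dots> = (\<Sum>k=1..n. \<Sum>d=1..m. if d dvd k then mangoldt d else 0)"
  proof (rule sum.cong[OF refl])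
    fix k assume k: "k \<in> {1..n}"
    have "{d. d dvd k} = {d \<in> {1..m}. d dvd k}"
      using k assms dvd_imp_le[of _ k] by (auto simp: Suc_le_eq dvd_pos_nat intro: order_trans)
    then show "(\<Sum>d | d dvd k. mangoldt d) = (\<Sum>d=1..m. if d dvd k then mangoldt d else (0::real))"
      by (simp only: sum.inter_filter[symmetric] finite_atLeastAtMost)
  qed
  also have "\<dots> = (\<Sum>d=1..m. \<Sum>k=1..n. if d dvd k then mangoldt d else 0)"
    by (rule sum.swap)
  also have "\<dots> = (\<Sum>d=1..m. mangoldt d * real (n div d))"
  proof (intro sum.cong refl)
    fix d assume d: "d \<in> {1..m}"
    have "(\<Sum>k=1..n. if d dvd k then mangoldt d else 0) = real (card ({1..n} \<inter> {k. d dvd k})) * mangoldt d"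
      by (simp add: sum.If_cases)
    also have "card ({1..n} \<inter> {k. d dvd k}) = n div d"
      using d eq[of d] by (subst eq) (auto simp: card_image inj_on_def)
    finally show "(\<Sum>k=1..n. if d dvd k then mangoldt d else 0) = mangoldt d * real (n div d)"
      by simp
  qed
  finally show ?thesis .
qed

lemma ln_binomial_eq_sum_mangoldt:
  assumes "k \<le> n"
  shows "ln (real (n choose k)) =
    (\<Sum>d=1..n. mangoldt d * (real (n div d) - real (k div d) - real ((n - k) div d)))"
proof -
  have "ln (real (n choose k)) = ln (fact n) - ln (fact k) - ln (fact (n - k))"
    using assms by (simp add: binomial_fact ln_div ln_mult)
  also have "\<dots> = (\<Sum>d=1..n. mangoldt d * (real (n div d) - real (k div d) - real ((n - k) div d)))"
    using assms by (simp add: ln_fact_eq_sum_mangoldt[of _ n] sum_subtractf[symmetric] algebra_simps)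
  finally show ?thesis .
qed

text \<open>For m < d <= n both k div d and (n - k) div d are 0 while n div d >= 1, so
  \<open>mangoldt d\<close> enters the logarithm with coefficient at least 1. The other coefficients
  are nonnegative because rounding down is superadditive.\<close>

lemma psi_diff_le:
  assumes "k \<le> m" "m < n" "n - k \<le> m"
  shows "psi n - psi m \<le> ln (real (n choose k))"
proof -
  have "{1..n} = {1..m} \<union> {m<..n}" using assms by auto
  then have "psi n - psi m = (\<Sum>d\<in>{m<..n}. mangoldt d)"
    unfolding psi_def by (subst \<open>{1..n} = _\<close>, subst sum.union_disjoint) auto
  also have "\<dots> \<le> (\<Sum>d\<in>{m<..n}. mangoldt d * (real (n div d) - real (k div d) - real ((n - k) div d)))"
  proof (intro sum_mono)
    fix d assume d: "d \<in> {m<..n}"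
    then have "n div d \<ge> 1" using div_le_mono[of d n d] by auto
    moreover have "k div d = 0" "(n - k) div d = 0" using d assms by auto
    ultimately show "mangoldt d \<le> mangoldt d * (real (n div d) - real (k div d) - real ((n - k) div d))"
      using mult_left_mono[of 1 "real (n div d)" "mangoldt d"] mangoldt_nonneg[of d] by simp
  qed
  also have "\<dots> \<le> (\<Sum>d=1..n. mangoldt d * (real (n div d) - real (k div d) - real ((n - k) div d)))"
  proof (intro sum_mono2)
    fix d
    have "k div d + (n - k) div d \<le> (k + (n - k)) div d" using div_add1_eq[of k "n - k" d] by linarith
    then have "real (k div d) + real ((n - k) div d) \<le> real (n div d)"
      using assms by (simp flip: of_nat_add)
    then show "0 \<le> mangoldt d * (real (n div d) - real (k div d) - real ((n - k) div d))"
      by (intro mult_nonneg_nonneg mangoldt_nonneg) auto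
  qed auto
  also have "\<dots> = ln (real (n choose k))" using assms by (intro ln_binomial_eq_sum_mangoldt[symmetric]) auto
  finally show ?thesis .
qed

lemma binomial_central_le:
  "2 * n choose n \<le> 4 ^ n" "(2 * n + 1) choose n \<le> 4 ^ n"
proof -
  have "2 * n choose n \<le> (\<Sum>k\<le>2*n. 2 * n choose k)" by (rule member_le_sum) auto
  then show "2 * n choose n \<le> 4 ^ n" by (simp add: choose_row_sum power_mult)
  have "((2 * n + 1) choose n) + ((2 * n + 1) choose (n + 1)) = (\<Sum>k\<in>{n, n+1}. (2 * n + 1) choose k)"
    by simp
  also have "\<dots> \<le> (\<Sum>k\<le>2*n+1. (2 * n + 1) choose k)" by (rule sum_mono2) auto
  also have "\<dots> = 2 * 4 ^ n" using choose_row_sum[of "2*n+1"] by (simp add: power_mult)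
  finally show "(2 * n + 1) choose n \<le> 4 ^ n"
    using binomial_symmetric[of n "2*n+1"] by simp
qed

text \<open>Induction by halving: with h = n div 2, the block (n - h, n] contributes at most ln (n
  choose h) <= h ln 4.\<close>

lemma psi_le: "psi n \<le> real n * ln 4"
proof (induction n rule: less_induct)
  case (less n)
  show ?case
  proof (cases "n \<le> 1")
    case True
    then have "n = 0 \<or> n = 1" by auto
    then show ?thesis by (auto simp: psi_def)
  next
    case False
    define h where "h = n div 2"
    define m where "m = n - h"
    have h: "h \<le> m" "m < n" "n - h \<le> m" using False by (auto simp: h_def m_def)
    have "n = 2 * h \<or> n = 2 * h + 1" by (auto simp: h_def)
    then have "(n choose h) \<le> 4 ^ h" using binomial_central_le by metis
    then have "real (n choose h) \<le> 4 ^ h" by (metis of_nat_le_iff of_nat_numeral of_nat_power)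
    then have "ln (real (n choose h)) \<le> ln (4 ^ h)"
      using h by (subst ln_le_cancel_iff) auto
    then have "psi n - psi m \<le> real h * ln 4" using psi_diff_le[OF h] by (simp add: ln_realpow)
    moreover have "psi m \<le> real m * ln 4" using less h by simp
    moreover have "real n = real m + real h" using h by (simp add: m_def)
    ultimately show ?thesis by (simp add: algebra_simps)
  qed
qed

text \<open>The factor 1/3 is what remains of about n ln 4, the logarithm of the central binomial
  coefficient, after the d <= 2n/3 have taken at most (2n/3) ln 4.\<close>

lemma sum_mangoldt_ge:
  assumes "n \<ge> 1"
  shows "(\<Sum>d\<in>{n<..2*n}. mangoldt d) \<ge> real n / 3 * ln 4 - ln (2 * real n)"
proof -
  have "4 ^ n / (2 * real n) \<le> real (2 * n choose n)" using assms by (intro central_binomial_lower_bound) auto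
  then have "ln (4 ^ n / (2 * real n)) \<le> ln (real (2 * n choose n))"
    using assms by (subst ln_le_cancel_iff) auto
  then have "real n * ln 4 - ln (2 * real n) \<le> ln (real (2 * n choose n))"
    using assms by (simp add: ln_div ln_realpow)
  also have "\<dots> = (\<Sum>d=1..2*n. mangoldt d * (real (2 * n div d) - real (n div d) - real (n div d)))"
    using ln_binomial_eq_sum_mangoldt[of n "2*n"] by simp
  \<comment> \<open>For 2n/3 < d <= n the quotient 2n div d is at most 2 and n div d is at least 1,
    so these coefficients are not positive.\<close>
  also have "\<dots> \<le> (\<Sum>d=1..2*n. mangoldt d * (if d \<in> {2*n div 3<..n} then 0 else 1))"
  proof (intro sum_mono mult_left_mono mangoldt_nonneg)
    fix d assume d: "d \<in> {1..2*n}"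
    show "real (2 * n div d) - real (n div d) - real (n div d) \<le> (if d \<in> {2*n div 3<..n} then 0 else 1)"
    proof (cases "d \<in> {2*n div 3<..n}")
      case True
      then have "2 * n < 3 * d" by (auto simp: div_less_iff_less_mult)
      then have "2 * n div d < 3" using d by (simp add: div_less_iff_less_mult)
      moreover have "n div d \<ge> 1" using div_le_mono[of d n d] d True by auto
      ultimately show ?thesis using True by simp
    next
      case False
      have "n < d + n div d * d" using d by (intro dividend_less_div_times) auto
      then have "2 * n < 2 * (d + n div d * d)" by (rule mult_less_mono2) simp
      also have "\<dots> = (2 * (n div d) + 2) * d" by algebra
      finally have "2 * n < (2 * (n div d) + 2) * d" .
      then have "2 * n div d < 2 * (n div d) + 2" using d by (simp add: div_less_iff_less_mult)
      then show ?thesis unfolding if_not_P[OF False] by linarith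
    qed
  qed
  also have "\<dots> = (\<Sum>d\<in>{1..2*n div 3} \<union> {n<..2*n}. mangoldt d)"
    by (intro sum.mono_neutral_cong_right) auto
  also have "\<dots> = psi (2 * n div 3) + (\<Sum>d\<in>{n<..2*n}. mangoldt d)"
    unfolding psi_def by (intro sum.union_disjoint) auto
  also have "psi (2 * n div 3) \<le> real (2 * n div 3) * ln 4" by (rule psi_le)
  also have "\<dots> \<le> (2 * real n / 3) * ln 4" by (intro mult_right_mono) (linarith, simp)
  finally show ?thesis by (simp add: algebra_simps)
qed

text \<open>Every term of the preceding sum is at most ln (2n), so only the proper prime powers have
  to be discarded. Their bases are at most sqrt (2n), and each base has at most one power in (n,
  2n].\<close>

lemma card_primes_ge:
  assumes "n \<ge> 1"
  shows "real (card {p. prime p \<and> n < p \<and> p \<le> 2 * n}) * ln (2 * real n) \<ge>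
    real n / 3 * ln 4 - ln (2 * real n) - sqrt (2 * real n) * ln (2 * real n)"
proof -
  define P where "P = {p. prime p \<and> n < p \<and> p \<le> 2 * n}"
  define Q where "Q = {d \<in> {n<..2*n}. primepow d \<and> \<not> prime d}"
  have fin: "finite P" "finite Q" by (auto simp: P_def Q_def)
  have inj: "inj_on aprimedivisor Q"
  proof (rule inj_onI)
    fix d e assume de: "d \<in> Q" "e \<in> Q" and eq: "aprimedivisor d = aprimedivisor e"
    obtain p i where p: "prime p" "i > 0" "d = p ^ i" using de by (auto simp: Q_def primepow_def)
    obtain p' j where p': "prime p'" "j > 0" "e = p' ^ j" using de by (auto simp: Q_def primepow_def)
    have [simp]: "p' = p" using eq p p' by (simp add: aprimedivisor_prime_power)
    \<comment> \<open>Distinct powers of p differ by a factor of at least 2, too much for (n,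
      2n].\<close>
    have lt: False if "a < b" "n < p ^ a" "p ^ b \<le> 2 * n" for a b
    proof -
      have "2 * p ^ a \<le> p * p ^ a" using prime_ge_2_nat[OF p(1)] by (intro mult_right_mono) auto
      also have "\<dots> = p ^ Suc a" by simp
      also have "\<dots> \<le> p ^ b" using that prime_ge_1_nat[OF p(1)] by (intro power_increasing) auto
      finally show False using that by linarith
    qed
    have "i = j" using lt[of i j] lt[of j i] de p p' by (auto simp: Q_def intro: linorder_cases)
    then show "d = e" using p p' by simp
  qed
  have "aprimedivisor ` Q \<subseteq> {1..nat \<lfloor>sqrt (2 * real n)\<rfloor>}"
  proof
    fix q assume "q \<in> aprimedivisor ` Q"
    then obtain d where d: "d \<in> Q" "q = aprimedivisor d" by auto
    obtain p i where p: "prime p" "i > 0" "d = p ^ i" using d by (auto simp: Q_def primepow_def)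
    have "q = p" using d p by (simp add: aprimedivisor_prime_power)
    have "i \<noteq> 1" using p d by (auto simp: Q_def)
    then have "p ^ 2 \<le> p ^ i" using p prime_ge_1_nat[OF p(1)] by (intro power_increasing) auto
    also have "\<dots> \<le> 2 * n" using d p by (auto simp: Q_def)
    finally have "real (p ^ 2) \<le> real (2 * n)" by (simp only: of_nat_le_iff)
    then have "real p \<le> sqrt (2 * real n)" by (intro real_le_rsqrt) simp
    then show "q \<in> {1..nat \<lfloor>sqrt (2 * real n)\<rfloor>}"
      using \<open>q = p\<close> prime_ge_1_nat[OF p(1)] by (auto simp: le_nat_iff le_floor_iff)
  qed
  then have "card (aprimedivisor ` Q) \<le> card {1..nat \<lfloor>sqrt (2 * real n)\<rfloor>}" by (intro card_mono) auto
  then have "card Q \<le> nat \<lfloor>sqrt (2 * real n)\<rfloor>" by (simp add: card_image[OF inj])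
  then have cardQ: "real (card Q) \<le> sqrt (2 * real n)" by (simp add: le_nat_iff le_floor_iff)
  have "(\<Sum>d\<in>{n<..2*n}. mangoldt d) = (\<Sum>d\<in>P \<union> Q. mangoldt d :: real)"
    by (intro sum.mono_neutral_right) (auto simp: P_def Q_def mangoldt_def)
  also have "\<dots> \<le> (\<Sum>d\<in>P \<union> Q. ln (2 * real n))"
  proof (rule sum_mono)
    fix d assume "d \<in> P \<union> Q"
    then have d: "n < d" "d \<le> 2 * n" by (auto simp: P_def Q_def)
    have "mangoldt d \<le> ln (real d)" using d by (intro mangoldt_le) auto
    also have "\<dots> \<le> ln (2 * real n)" using d by (subst ln_le_cancel_iff) (auto simp flip: of_nat_le_iff)
    finally show "mangoldt d \<le> ln (2 * real n)" .
  qed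
  also have "\<dots> \<le> real (card P + card Q) * ln (2 * real n)"
    using card_Un_le[of P Q] assms by (auto intro!: mult_right_mono simp flip: of_nat_add)
  also have "\<dots> \<le> real (card P) * ln (2 * real n) + sqrt (2 * real n) * ln (2 * real n)"
    using cardQ assms by (auto simp: algebra_simps intro!: mult_left_mono)
  finally show ?thesis using sum_mangoldt_ge[OF assms] unfolding P_def by linarith
qed

lemma finite_primes_half_upto: "finite (primes_half_upto M)"
  by (rule finite_subset[of _ "{..M}"]) (auto simp: primes_half_upto_def)

lemma primes_half_uptoD:
  assumes "N \<in> primes_half_upto M"
  shows "prime N" "real M / 2 \<le> real N"
proof -
  show "prime N" using assms by (simp add: primes_half_upto_def)
  have "\<lceil>real M / 2\<rceil> < int N" using assms by (simp add: primes_half_upto_def)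
  then have "real_of_int \<lceil>real M / 2\<rceil> < real N" by (metis of_int_less_iff of_int_of_nat_eq)
  then show "real M / 2 \<le> real N" using le_of_int_ceiling[of "real M / 2"] by linarith
qed

text \<open>Giving up M^\<epsilon> absorbs the logarithm. For small M a single prime suffices, which
  is why the set is assumed to be nonempty; over an empty set the average in the error is 0.\<close>

lemma card_primes_half_upto_ge:
  fixes \<epsilon> :: real
  assumes "0 < \<epsilon>" "\<epsilon> < 1"
  shows "\<exists>c>0. \<forall>M. primes_half_upto M \<noteq> {} \<longrightarrow> c * real M powr (1 - \<epsilon>) \<le> real (card (primes_half_upto M))"
proof -
  have "exp 1 \<le> (4::real)" using exp_le by simp
  then have ln4: "1 \<le> ln (4::real)" by (simp add: ln_ge_iff)
  have "eventually (\<lambda>x::real. x > 1) at_top" by (rule eventually_gt_at_top)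
  moreover have "eventually (\<lambda>x::real. (2*x) powr (1 - \<epsilon>) * ln (2*x) \<le> x/3 - ln (2*x) - sqrt (2*x) * ln (2*x)) at_top"
    using assms by real_asymp
  ultimately have "eventually (\<lambda>x::real. x > 1 \<and> (x/3 * ln 4 - ln (2*x) - sqrt (2*x) * ln (2*x)) / ln (2*x) \<ge> (2*x) powr (1 - \<epsilon>)) at_top"
  proof eventually_elim
    case (elim x)
    have "x / 3 * 1 \<le> x / 3 * ln 4" using elim ln4 by (intro mult_left_mono) auto
    then have "(2*x) powr (1 - \<epsilon>) * ln (2*x) \<le> x/3 * ln 4 - ln (2*x) - sqrt (2*x) * ln (2*x)"
      using elim(2) by linarith
    then show ?case using elim(1) by (simp add: pos_le_divide_eq)
  qed
  then obtain x0 :: real where x0: "\<And>x. x \<ge> x0 \<Longrightarrow> x > 1 \<and> (x/3 * ln 4 - ln (2*x) - sqrt (2*x) * ln (2*x)) / ln (2*x) \<ge> (2*x) powr (1 - \<epsilon>)"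
    by (auto simp: eventually_at_top_linorder)
  \<comment> \<open>If M > 2 |x0|, then n >= M/2 lies in the asymptotic range; if M <= K, then the
    left side of the claim is at most 1.\<close>
  define K where "K = max 1 (2 * \<bar>x0\<bar>)"
  have K1: "K \<ge> 1" by (simp add: K_def)
  show ?thesis
  proof (intro exI[of _ "1 / K"] conjI allI impI)
    show "1 / K > 0" by (simp add: K_def)
    fix M assume ne: "primes_half_upto M \<noteq> {}"
    then obtain N where "prime N" "N \<le> M" by (auto simp: primes_half_upto_def)
    then have "M \<ge> 1" using prime_ge_1_nat[of N] by linarith
    show "1 / K * real M powr (1 - \<epsilon>) \<le> real (card (primes_half_upto M))"
    proof (cases "real M \<le> K")
      case True
      have "real M powr (1 - \<epsilon>) \<le> real M powr 1" using assms \<open>M \<ge> 1\<close> by (intro powr_mono) auto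
      also have "\<dots> \<le> K" using True \<open>M \<ge> 1\<close> by simp
      finally have "1 / K * real M powr (1 - \<epsilon>) \<le> 1" using K1 by (simp add: pos_divide_le_eq)
      also have "1 \<le> card (primes_half_upto M)" using ne finite_primes_half_upto[of M] by (simp add: Suc_le_eq card_gt_0_iff)
      then have "1 \<le> real (card (primes_half_upto M))" by simp
      finally show ?thesis .
    next
      case False
      \<comment> \<open>This is M/2 rounded up, so that the lower ends of (n, 2n] and of the range
        of N coincide.\<close>
      define n where "n = (M + 1) div 2"
      have n: "M \<le> 2 * n" "2 * n \<le> M + 1" by (auto simp: n_def)
      have rn: "real M \<le> 2 * real n" "2 * real n \<le> real M + 1" using n by linarith+
      have "2 * \<bar>x0\<bar> < real M" using False unfolding K_def by linarith
      then have "x0 \<le> real n" using rn by linarith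
      note x = x0[OF this]
      have n2: "n \<ge> 2" using x by auto
      have cl: "\<lceil>real M / 2\<rceil> \<le> int n" unfolding ceiling_le_iff using rn by simp
      have sub: "{p. prime p \<and> n < p \<and> p \<le> 2 * n} \<subseteq> primes_half_upto M"
      proof
        fix p assume "p \<in> {p. prime p \<and> n < p \<and> p \<le> 2 * n}"
        then have p: "prime p" "n < p" "p \<le> 2 * n" by auto
        \<comment> \<open>For odd M the endpoint 2n equals M + 1 and has to be excluded; it is even
          and larger than 2.\<close>
        have "p \<noteq> 2 * n"
        proof
          assume "p = 2 * n"
          then have "2 = p" using p(1) by (intro primes_dvd_imp_eq two_is_prime_nat) auto
          then show False using \<open>p = 2 * n\<close> n2 by linarith
        qed
        then show "p \<in> primes_half_upto M" using p n cl by (auto simp: primes_half_upto_def)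
      qed
      define B where "B = real n / 3 * ln 4 - ln (2 * real n) - sqrt (2 * real n) * ln (2 * real n)"
      have ln0: "ln (2 * real n) > 0" using n2 by simp
      have "1 / K * real M powr (1 - \<epsilon>) \<le> 1 * real M powr (1 - \<epsilon>)"
        using K1 by (intro mult_right_mono) auto
      then have a: "1 / K * real M powr (1 - \<epsilon>) \<le> real M powr (1 - \<epsilon>)" by simp
      have b: "real M powr (1 - \<epsilon>) \<le> (2 * real n) powr (1 - \<epsilon>)"
        using rn assms by (intro powr_mono2) auto
      have c: "(2 * real n) powr (1 - \<epsilon>) \<le> B / ln (2 * real n)"
        using conjunct2[OF x] unfolding B_def .
      have d: "B / ln (2 * real n) \<le> real (card {p. prime p \<and> n < p \<and> p \<le> 2 * n})"
        unfolding pos_divide_le_eq[OF ln0] B_def using n2 by (intro card_primes_ge) simp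
      have e: "real (card {p. prime p \<and> n < p \<and> p \<le> 2 * n}) \<le> real (card (primes_half_upto M))"
        by (rule of_nat_mono, rule card_mono[OF finite_primes_half_upto sub])
      show ?thesis by (rule order_trans[OF a order_trans[OF b order_trans[OF c order_trans[OF d e]]]])
    qed
  qed
qed

subsection \<open>Infinite sums\<close>

text \<open>The shares a/(a+b) and b/(a+b) lie in [0, 1], where t <= t powr p, and they sum to
  1.\<close>

lemma powr_add_le:
  fixes a b p :: real
  assumes "0 \<le> a" "0 \<le> b" "0 < p" "p \<le> 1"
  shows "(a + b) powr p \<le> a powr p + b powr p"
proof (cases "a + b = 0")
  case True
  then show ?thesis using assms by simp
next
  case False
  have *: "t / (a + b) * (a + b) powr p \<le> t powr p" if "0 \<le> t" "t \<le> a + b" for t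
  proof -
    have "t / (a + b) \<le> (t / (a + b)) powr p"
      using powr_mono'[of p 1 "t / (a + b)"] that assms False by (auto simp: divide_simps)
    then have "t / (a + b) * (a + b) powr p \<le> (t / (a + b)) powr p * (a + b) powr p"
      by (intro mult_right_mono) auto
    also have "\<dots> = t powr p" using that assms False by (simp flip: powr_mult)
    finally show ?thesis .
  qed
  have "(a + b) powr p = a / (a + b) * (a + b) powr p + b / (a + b) * (a + b) powr p"
    using False by (simp flip: distrib_right add_divide_distrib)
  also have "\<dots> \<le> a powr p + b powr p" using *[of a] *[of b] assms by (intro add_mono) auto
  finally show ?thesis .
qed

lemma powr_sum_le:
  fixes f :: "'a \<Rightarrow> real"
  assumes "\<And>x. x \<in> A \<Longrightarrow> 0 \<le> f x" "0 < p" "p \<le> 1"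
  shows "(\<Sum>x\<in>A. f x) powr p \<le> (\<Sum>x\<in>A. f x powr p)"
  using assms
proof (induction A rule: infinite_finite_induct)
  case (insert x F)
  have "(f x + (\<Sum>x\<in>F. f x)) powr p \<le> f x powr p + (\<Sum>x\<in>F. f x) powr p"
    using insert by (intro powr_add_le sum_nonneg) auto
  also have "\<dots> \<le> f x powr p + (\<Sum>x\<in>F. f x powr p)" using insert by auto
  finally show ?case using insert by simp
qed auto

lemma powr_infsum_le:
  fixes f :: "'a \<Rightarrow> real"
  assumes "\<And>x. x \<in> A \<Longrightarrow> 0 \<le> f x" "0 < p" "p \<le> 1"
    and "f summable_on A" "(\<lambda>x. f x powr p) summable_on A"
  shows "(\<Sum>\<^sub>\<infinity>x\<in>A. f x) powr p \<le> (\<Sum>\<^sub>\<infinity>x\<in>A. f x powr p)"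
proof -
  define S where "S = (\<Sum>\<^sub>\<infinity>x\<in>A. f x powr p)"
  have S0: "S \<ge> 0" unfolding S_def by (intro infsum_nonneg) auto
  have "(\<Sum>\<^sub>\<infinity>x\<in>A. f x) \<le> S powr (1 / p)"
  proof (rule infsum_le_finite_sums[OF assms(4)])
    fix F assume F: "finite F" "F \<subseteq> A"
    have "(\<Sum>x\<in>F. f x) powr p \<le> (\<Sum>x\<in>F. f x powr p)" using F assms by (intro powr_sum_le) auto
    also have "\<dots> \<le> S" unfolding S_def using F assms by (intro finite_sum_le_infsum) auto
    finally have "((\<Sum>x\<in>F. f x) powr p) powr (1 / p) \<le> S powr (1 / p)"
      using assms by (intro powr_mono2) auto
    then show "(\<Sum>x\<in>F. f x) \<le> S powr (1 / p)"
      using assms F by (auto simp: powr_powr sum_nonneg subset_iff)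
  qed
  then have "(\<Sum>\<^sub>\<infinity>x\<in>A. f x) powr p \<le> (S powr (1 / p)) powr p"
    using assms by (intro powr_mono2 infsum_nonneg) auto
  then show ?thesis using assms S0 by (simp add: powr_powr S_def)
qed

text \<open>Only summability needs an argument: a finite set of families lies in the finite box of
  its coordinate projections, and over a box the sum of products factorizes.\<close>

lemma has_sum_prod_PiE_nonneg:
  fixes f :: "'a \<Rightarrow> 'b \<Rightarrow> real"
  assumes "finite A" "\<And>x y. x \<in> A \<Longrightarrow> y \<in> B x \<Longrightarrow> 0 \<le> f x y" "\<And>x. x \<in> A \<Longrightarrow> f x summable_on B x"
  shows "((\<lambda>g. \<Prod>x\<in>A. f x (g x)) has_sum (\<Prod>x\<in>A. infsum (f x) (B x))) (PiE A B)"
proof -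
  have summ: "(\<lambda>g. \<Prod>x\<in>A. f x (g x)) summable_on PiE A B"
  proof (rule nonneg_bdd_above_summable_on)
    show "bdd_above (sum (\<lambda>g. \<Prod>x\<in>A. f x (g x)) ` {F. F \<subseteq> PiE A B \<and> finite F})"
    proof (rule bdd_aboveI2)
      fix F assume "F \<in> {F. F \<subseteq> PiE A B \<and> finite F}"
      then have F: "F \<subseteq> PiE A B" "finite F" by auto
      define D where "D = (\<lambda>x. (\<lambda>g. g x) ` F)"
      have D: "D x \<subseteq> B x" "finite (D x)" if "x \<in> A" for x using F that by (auto simp: D_def)
      have "(\<Sum>g\<in>F. \<Prod>x\<in>A. f x (g x)) \<le> (\<Sum>g\<in>PiE A D. \<Prod>x\<in>A. f x (g x))"
      proof (rule sum_mono2)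
        show "finite (PiE A D)" using assms D by (intro finite_PiE) auto
        show "F \<subseteq> PiE A D" using F by (auto simp: D_def PiE_def)
        show "0 \<le> (\<Prod>x\<in>A. f x (g x))" if "g \<in> PiE A D - F" for g
          using that D assms(2) by (intro prod_nonneg ballI) (meson DiffD1 PiE_mem subsetD)
      qed
      also have "\<dots> = (\<Prod>x\<in>A. \<Sum>y\<in>D x. f x y)"
        using assms D by (intro prod_sum_PiE[symmetric]) auto
      also have "\<dots> \<le> (\<Prod>x\<in>A. infsum (f x) (B x))"
        using D assms by (intro prod_mono conjI finite_sum_le_infsum sum_nonneg) (auto simp: subset_iff)
      finally show "(\<Sum>g\<in>F. \<Prod>x\<in>A. f x (g x)) \<le> (\<Prod>x\<in>A. infsum (f x) (B x))" .
    qed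
  qed (use assms in \<open>auto intro!: prod_nonneg simp: PiE_def Pi_def\<close>)
  have "infsum (\<lambda>g. \<Prod>x\<in>A. f x (g x)) (PiE A B) = (\<Prod>x\<in>A. infsum (f x) (B x))"
    using assms summ by (intro infsum_prod_PiE) auto
  then show ?thesis using summ has_sum_infsum by metis
qed

lemma summable_on_int_powr:
  fixes a :: real
  assumes "a > 1"
  shows "(\<lambda>m::int. \<bar>real_of_int m\<bar> powr - a) summable_on - {0}"
proof -
  have "summable (\<lambda>n. real n powr - a)" using assms by (simp add: summable_real_powr_iff)
  then have "(\<lambda>n. real n powr - a) summable_on UNIV"
    by (subst summable_on_UNIV_nonneg_real_iff) auto
  then have nat: "(\<lambda>n. real n powr - a) summable_on {1..}" by (rule summable_on_subset_banach) auto
  have "(\<lambda>m::int. \<bar>real_of_int m\<bar> powr - a) summable_on (int ` {1..})"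
    using nat by (subst summable_on_reindex) (auto simp: o_def)
  moreover have "(\<lambda>m::int. \<bar>real_of_int m\<bar> powr - a) summable_on ((\<lambda>n. - int n) ` {1..})"
    using nat by (subst summable_on_reindex) (auto simp: o_def inj_on_def)
  ultimately have "(\<lambda>m::int. \<bar>real_of_int m\<bar> powr - a) summable_on (int ` {1..} \<union> (\<lambda>n. - int n) ` {1..})"
    by (rule summable_on_union)
  also have "int ` {1..} \<union> (\<lambda>n. - int n) ` {1..} = - {0}"
  proof (intro equalityI subsetI)
    fix m :: int assume m: "m \<in> - {0}"
    show "m \<in> int ` {1..} \<union> (\<lambda>n. - int n) ` {1..}"
    proof (cases "m > 0")
      case True then have "m = int (nat m)" "nat m \<in> {1..}" by auto
      then show ?thesis by blast
    next
      case False then have "m = - int (nat (- m))" "nat (- m) \<in> {1..}" using m by auto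
      then show ?thesis by blast
    qed
  qed auto
  finally show ?thesis .
qed

subsection \<open>Component-by-component construction\<close>

text \<open>The counting half of Markov's inequality: S consists of the elements that were not
  taken, together with c itself. Counting c is worth 1, which later offsets the rounding of
  t.\<close>

lemma sort_key_take_le:
  fixes f :: "'a \<Rightarrow> 'b :: linorder"
  assumes "distinct xs" "c \<in> set (take t (sort_key f xs))"
  obtains S where "S \<subseteq> set xs" "length xs + 1 \<le> card S + t" "\<And>x. x \<in> S \<Longrightarrow> f c \<le> f x"
proof
  define ys where "ys = sort_key f xs"
  have ys: "distinct ys" "set ys = set xs" "length ys = length xs" "sorted (map f ys)"
    using assms by (simp_all add: ys_def)
  have c: "c \<in> set (take t ys)" using assms by (simp add: ys_def)
  show "insert c (set (drop t ys)) \<subseteq> set xs"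
    using c ys(2) set_take_subset[of t ys] set_drop_subset[of t ys] by auto
  have "c \<notin> set (drop t ys)"
    using c ys(1) set_take_disj_set_drop_if_distinct[of ys t t] by auto
  then have "card (insert c (set (drop t ys))) = length (drop t ys) + 1"
    using ys(1) by (simp add: distinct_card)
  then show "length xs + 1 \<le> card (insert c (set (drop t ys))) + t" using ys(3) by simp
  have "sorted (map f (take t ys) @ map f (drop t ys))" using ys(4) by (simp flip: map_append)
  then show "f c \<le> f x" if "x \<in> insert c (set (drop t ys))" for x
    using that c by (auto simp: sorted_append)
qed

section \<open>Reciprocal weights and sums of their powers\<close>

locale korobov_weights =
  fixes \<alpha> q :: real and \<gamma> :: "nat \<Rightarrow> real"
  assumes q_gt: "1/2 < q" and q_less: "q < \<alpha>"
    and weights: "\<And>j. j \<ge> 1 \<Longrightarrow> 0 \<le> \<gamma> j \<and> \<gamma> j \<le> 1"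
begin

text \<open>The reciprocal of one factor of \<open>korobov_r\<close>. In this form a vanishing
  weight gives a genuine 0 at nonzero m, and all values for j >= 1 lie in [0, 1].\<close>

definition w :: "nat \<Rightarrow> int \<Rightarrow> real"
  where "w j m = (if m = 0 then 1 else \<gamma> j / \<bar>real_of_int m\<bar> powr \<alpha>)"

definition W :: "nat \<Rightarrow> (nat \<Rightarrow> int) \<Rightarrow> real"
  where "W l k = (\<Prod>j=1..l. w j (k j))"

text \<open>This is 2 zeta(\<alpha>/q), as a sum over the nonzero integers.\<close>

definition Z :: real where "Z = (\<Sum>\<^sub>\<infinity>m\<in>- {0::int}. \<bar>real_of_int m\<bar> powr - (\<alpha> / q))"

definition g :: "nat \<Rightarrow> real" where "g j = \<gamma> j powr (1 / q) * Z"

definition T :: "nat \<Rightarrow> real" where "T l = (\<Prod>j=1..l. 1 + g j)"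

lemma Z_nonneg: "Z \<ge> 0" unfolding Z_def by (intro infsum_nonneg) auto

lemma g_nonneg: "g j \<ge> 0" using Z_nonneg by (simp add: g_def)

lemma T_Suc: "T (Suc n) = T n * (1 + g (Suc n))" by (simp add: T_def)

lemma T_ge_1: "T n \<ge> 1"
  unfolding T_def by (rule prod_ge_1) (use g_nonneg in auto)

lemma inverse_korobov_r: "1 / korobov_r \<alpha> \<gamma> l k = W l k"
proof -
  have "1 / korobov_r \<alpha> \<gamma> l k = (\<Prod>j | j \<in> {1..l} \<and> k j \<noteq> 0. 1 / (\<bar>real_of_int (k j)\<bar> powr \<alpha> / \<gamma> j))"
    unfolding korobov_r_def by (simp add: prod_dividef)
  also have "\<dots> = (\<Prod>j\<in>{1..l}. if k j \<noteq> 0 then 1 / (\<bar>real_of_int (k j)\<bar> powr \<alpha> / \<gamma> j) else 1)"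
    by (rule prod.inter_filter) auto
  also have "\<dots> = W l k" unfolding W_def by (rule prod.cong) (auto simp: w_def)
  finally show ?thesis .
qed

lemma inverse_korobov_r_sq: "1 / (korobov_r \<alpha> \<gamma> l k)\<^sup>2 = (W l k)\<^sup>2"
  by (metis inverse_korobov_r one_power2 power_divide)

lemma w_bounds: assumes "j \<ge> 1" shows "0 \<le> w j m" "w j m \<le> 1"
proof -
  have "1 \<le> \<bar>real_of_int m\<bar> powr \<alpha>" if "m \<noteq> 0"
    using that q_gt q_less by (intro ge_one_powr_ge_zero) auto
  then show "0 \<le> w j m" "w j m \<le> 1"
    using weights[OF assms] by (auto simp: w_def divide_le_eq)
qed

lemma W_bounds: "0 \<le> W l k" "W l k \<le> 1"
  unfolding W_def by (auto intro!: prod_nonneg prod_le_1 w_bounds)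

lemma w_powr: "m \<noteq> 0 \<Longrightarrow> j \<ge> 1 \<Longrightarrow> w j m powr (1 / q) = \<gamma> j powr (1 / q) * \<bar>real_of_int m\<bar> powr - (\<alpha> / q)"
  using weights[of j] by (simp add: w_def powr_divide powr_powr powr_minus divide_simps)

lemma W_powr: "W l k powr (1 / q) = (\<Prod>j=1..l. w j (k j) powr (1 / q))"
  unfolding W_def by (rule prod_powr_distrib)

lemma has_sum_w_nonzero:
  assumes "j \<ge> 1" shows "((\<lambda>m. w j m powr (1 / q)) has_sum g j) (- {0})"
proof -
  have "\<alpha> / q > 1" using q_gt q_less by simp
  then have "((\<lambda>m::int. \<bar>real_of_int m\<bar> powr - (\<alpha> / q)) has_sum Z) (- {0})"
    unfolding Z_def by (intro has_sum_infsum summable_on_int_powr)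
  then have "((\<lambda>m::int. \<gamma> j powr (1 / q) * \<bar>real_of_int m\<bar> powr - (\<alpha> / q)) has_sum g j) (- {0})"
    unfolding g_def by (rule has_sum_cmult_right)
  then show ?thesis using w_powr assms by (subst has_sum_cong) auto
qed

lemma has_sum_w:
  assumes "j \<ge> 1" shows "((\<lambda>m. w j m powr (1 / q)) has_sum 1 + g j) UNIV"
proof -
  have "((\<lambda>m. w j m powr (1 / q)) has_sum w j 0 powr (1 / q) + g j) (insert 0 (- {0}))"
    using assms by (intro has_sum_insert has_sum_w_nonzero) auto
  moreover have "insert 0 (- {0}) = (UNIV :: int set)" by auto
  ultimately show ?thesis by (simp add: w_def)
qed

text \<open>Substituting m = N m' extracts the factor N powr - (\<alpha>/q), which is at most 1/N.
  Hence N - 1 choices of a component can all pay for these multiples at a total cost of at most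
  \<open>g j\<close>.\<close>

lemma infsum_w_multiples:
  assumes "j \<ge> 1" "N \<ge> 1"
  shows "(\<lambda>m. w j m powr (1 / q)) summable_on {m. m \<noteq> 0 \<and> int N dvd m}"
    and "(\<Sum>\<^sub>\<infinity>m\<in>{m. m \<noteq> 0 \<and> int N dvd m}. w j m powr (1 / q)) \<le> g j / real N"
proof -
  define f where "f = (\<lambda>m. w j m powr (1 / q))"
  have set_eq: "{m. m \<noteq> 0 \<and> int N dvd m} = (\<lambda>m. int N * m) ` (- {0})" using assms by auto
  have inj: "inj_on (\<lambda>m. int N * m) (- {0})" using assms by (auto simp: inj_on_def)
  have aq: "\<alpha> / q \<ge> 1" using q_gt q_less by simp
  have feq: "f (int N * m) = real N powr - (\<alpha> / q) * f m" if "m \<noteq> 0" for m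
    using that assms by (simp add: f_def w_powr abs_mult powr_mult)
  have "(f has_sum g j) (- {0})" using has_sum_w_nonzero assms by (simp add: f_def)
  then have "((\<lambda>m. real N powr - (\<alpha> / q) * f m) has_sum real N powr - (\<alpha> / q) * g j) (- {0})"
    by (rule has_sum_cmult_right)
  then have "((\<lambda>m. f (int N * m)) has_sum real N powr - (\<alpha> / q) * g j) (- {0})"
    by (subst has_sum_cong[OF feq]) auto
  then have hs: "(f has_sum real N powr - (\<alpha> / q) * g j) {m. m \<noteq> 0 \<and> int N dvd m}"
    unfolding set_eq by (subst has_sum_reindex[OF inj]) (simp add: o_def)
  then show "(\<lambda>m. w j m powr (1 / q)) summable_on {m. m \<noteq> 0 \<and> int N dvd m}"
    using has_sum_imp_summable unfolding f_def by blast
  have "real N powr - (\<alpha> / q) \<le> real N powr - 1" using assms aq by (intro powr_mono) auto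
  then have "real N powr - (\<alpha> / q) * g j \<le> real N powr - 1 * g j"
    by (intro mult_right_mono g_nonneg)
  also have "\<dots> = g j / real N" using assms by (simp add: powr_minus divide_simps)
  finally show "(\<Sum>\<^sub>\<infinity>m\<in>{m. m \<noteq> 0 \<and> int N dvd m}. w j m powr (1 / q)) \<le> g j / real N"
    using infsumI[OF hs] unfolding f_def by simp
qed

lemma has_sum_W_PiE:
  assumes "\<And>j. j \<in> {1..l} \<Longrightarrow> (\<lambda>m. w j m powr (1 / q)) summable_on B j"
  shows "((\<lambda>k. W l k powr (1 / q)) has_sum (\<Prod>j=1..l. \<Sum>\<^sub>\<infinity>m\<in>B j. w j m powr (1 / q))) (PiE {1..l} B)"
  unfolding W_powr using assms by (intro has_sum_prod_PiE_nonneg) auto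

lemma has_sum_W: "((\<lambda>k. W l k powr (1 / q)) has_sum T l) (int_vecs l)"
proof -
  have "((\<lambda>k. W l k powr (1 / q)) has_sum (\<Prod>j=1..l. \<Sum>\<^sub>\<infinity>m. w j m powr (1 / q))) (PiE {1..l} (\<lambda>_. UNIV))"
    by (intro has_sum_W_PiE) (use has_sum_w has_sum_imp_summable in auto)
  also have "(\<Prod>j=1..l. \<Sum>\<^sub>\<infinity>m. w j m powr (1 / q)) = T l"
    unfolding T_def by (intro prod.cong refl infsumI has_sum_w) auto
  finally show ?thesis by (simp add: int_vecs_def)
qed

lemma has_sum_W_last:
  assumes "(\<lambda>m. w (Suc n) m powr (1 / q)) summable_on B"
  shows "((\<lambda>k. W (Suc n) k powr (1 / q)) has_sum T n * (\<Sum>\<^sub>\<infinity>m\<in>B. w (Suc n) m powr (1 / q)))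
     {k \<in> int_vecs (Suc n). k (Suc n) \<in> B}"
proof -
  define B' where "B' = (\<lambda>j. if j = Suc n then B else UNIV)"
  have "{k \<in> int_vecs (Suc n). k (Suc n) \<in> B} = PiE {1..Suc n} B'"
    by (auto simp: int_vecs_def B'_def PiE_def Pi_def)
  moreover have "((\<lambda>k. W (Suc n) k powr (1 / q)) has_sum (\<Prod>j=1..Suc n. \<Sum>\<^sub>\<infinity>m\<in>B' j. w j m powr (1 / q))) (PiE {1..Suc n} B')"
    using assms has_sum_imp_summable[OF has_sum_w] by (intro has_sum_W_PiE) (auto simp: B'_def)
  moreover have "(\<Prod>j=1..n. \<Sum>\<^sub>\<infinity>m\<in>B' j. w j m powr (1 / q)) = T n"
    unfolding T_def by (intro prod.cong refl infsumI) (auto simp: B'_def has_sum_w)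
  ultimately show ?thesis by (simp add: B'_def)
qed

text \<open>Since W <= 1 and 1/q < 2, summability of the powers 1/q carries over to the
  squares.\<close>

lemma W_le_powr: "(W l k)\<^sup>2 \<le> W l k powr (1 / q)"
proof (cases "W l k = 0")
  case False
  then have "W l k powr 2 \<le> W l k powr (1 / q)" using W_bounds[of l k] q_gt
    by (intro powr_mono') (auto simp: divide_simps)
  then show ?thesis using False W_bounds[of l k] by (simp add: powr_numeral)
qed auto

lemma W_sq_powr: "((W l k)\<^sup>2) powr (1 / (2 * q)) = W l k powr (1 / q)"
proof (cases "W l k = 0")
  case False
  then have "(W l k)\<^sup>2 = W l k powr 2" using W_bounds[of l k] by (simp add: powr_numeral)
  then show ?thesis using q_gt by (simp add: powr_powr)
qed auto

lemma summable_W_powr: "A \<subseteq> int_vecs l \<Longrightarrow> (\<lambda>k. W l k powr (1 / q)) summable_on A"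
  by (rule summable_on_subset_banach[OF has_sum_imp_summable[OF has_sum_W]])

lemma summable_W_sq:
  assumes "A \<subseteq> int_vecs l" shows "(\<lambda>k. (W l k)\<^sup>2) summable_on A"
  by (rule summable_on_comparison_test[OF summable_W_powr[OF assms]]) (use W_le_powr in auto)

section \<open>Increments of R when a component is appended\<close>

definition theta :: "nat \<Rightarrow> nat \<Rightarrow> (nat \<Rightarrow> nat) \<Rightarrow> real"
  where "theta l N z = (\<Sum>\<^sub>\<infinity>k\<in>{k \<in> dual_lattice l N z. k l \<noteq> 0}. (W l k)\<^sup>2)"

lemma theta_nonneg: "theta l N z \<ge> 0"
  unfolding theta_def by (intro infsum_nonneg) auto

lemma dual_lattice_subset: "dual_lattice l N z \<subseteq> int_vecs l"
  by (auto simp: dual_lattice_def)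

lemma dual_lattice_cong:
  assumes "\<And>j. j \<in> {1..l} \<Longrightarrow> z j = z' j"
  shows "dual_lattice l N z = dual_lattice l N z'"
proof -
  have "(\<Sum>j=1..l. k j * int (z j)) = (\<Sum>j=1..l. k j * int (z' j))" for k :: "nat \<Rightarrow> int"
    using assms by (intro sum.cong) auto
  then show ?thesis unfolding dual_lattice_def by simp
qed

lemma mem_dual_lattice_Suc:
  "k \<in> dual_lattice (Suc n) N z \<longleftrightarrow> k \<in> int_vecs (Suc n) \<and>
     int N dvd ((\<Sum>j=1..n. k j * int (z j)) + k (Suc n) * int (z (Suc n)))"
  by (simp add: dual_lattice_def cong_0_iff)

text \<open>The exponent turns the squares into W powr (1/q), whose sum over all integer vectors is
  the product \<open>T l\<close>.\<close>

lemma theta_powr_le: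
  "theta l N z powr (1 / (2 * q)) \<le> (\<Sum>\<^sub>\<infinity>k\<in>{k \<in> dual_lattice l N z. k l \<noteq> 0}. W l k powr (1 / q))"
proof -
  have sub: "{k \<in> dual_lattice l N z. k l \<noteq> 0} \<subseteq> int_vecs l" using dual_lattice_subset by auto
  have "theta l N z powr (1 / (2 * q)) \<le> (\<Sum>\<^sub>\<infinity>k\<in>{k \<in> dual_lattice l N z. k l \<noteq> 0}. ((W l k)\<^sup>2) powr (1 / (2 * q)))"
    unfolding theta_def
    by (rule powr_infsum_le) (use q_gt summable_W_sq[OF sub] summable_W_powr[OF sub] in \<open>auto simp: W_sq_powr\<close>)
  then show ?thesis by (simp add: W_sq_powr)
qed

text \<open>The factor 2 has two sources. A vector k whose last entry is not divisible by N is dual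
  for at most one c, so these vectors contribute at most the full sum once. A vector whose last
  entry is a nonzero multiple of N may be dual for every c, but such vectors carry only a share 1/N
  of the full sum.\<close>

lemma sum_theta_le:
  assumes "prime N"
  shows "(\<Sum>c=1..N-1. theta (Suc n) N (z(Suc n := c)) powr (1 / (2 * q))) \<le> 2 * (g (Suc n) * T n)"
proof -
  define l where "l = Suc n"
  define f where "f = (\<lambda>k. W l k powr (1 / q))"
  have f0: "f k \<ge> 0" for k by (simp add: f_def)
  define D where "D = (\<lambda>c. {k \<in> dual_lattice l N (z(l := c)). k l \<noteq> 0})"
  define D' where "D' = (\<lambda>c. {k \<in> D c. \<not> int N dvd k l})"
  \<comment> \<open>The dual condition is dropped here, which makes E a product set independent of
    c.\<close>
  define E where "E = {k \<in> int_vecs l. k l \<in> {m. m \<noteq> 0 \<and> int N dvd m}}"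
  have N: "N \<ge> 2" using assms by (rule prime_ge_2_nat)
  have subD: "D c \<subseteq> int_vecs l" for c using dual_lattice_subset by (auto simp: D_def)
  then have subD': "D' c \<subseteq> int_vecs l" for c by (auto simp: D'_def)
  have subE: "E \<subseteq> int_vecs l" by (auto simp: E_def)
  have summ: "f summable_on A" if "A \<subseteq> int_vecs l" for A
    using summable_W_powr[OF that] by (simp add: f_def)
  have infE: "infsum f E \<le> g l * T n / real N"
  proof -
    have "infsum f E = T n * (\<Sum>\<^sub>\<infinity>m\<in>{m. m \<noteq> 0 \<and> int N dvd m}. w l m powr (1 / q))"
      unfolding E_def f_def l_def using N by (intro infsumI has_sum_W_last infsum_w_multiples) auto
    also have "\<dots> \<le> T n * (g l / real N)"
      using T_ge_1[of n] N by (intro mult_left_mono infsum_w_multiples) (auto simp: l_def)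
    finally show ?thesis by (simp add: mult_ac)
  qed
  have infD: "infsum f (D c) \<le> infsum f (D' c) + infsum f E" for c
  proof -
    have "infsum f (D c) \<le> infsum f (D' c \<union> E)"
      using subD[of c] subD'[of c] subE f0 by (intro infsum_mono2 summ) (auto simp: D'_def E_def D_def)
    also have "\<dots> = infsum f (D' c) + infsum f E"
      using subD' subE by (intro infsum_Un_disjoint summ) (auto simp: D'_def E_def)
    finally show ?thesis .
  qed
  have disj: "D' c \<inter> D' d = {}" if "c \<in> {1..N-1}" "d \<in> {1..N-1}" "c \<noteq> d" for c d
  proof (rule ccontr)
    assume "D' c \<inter> D' d \<noteq> {}"
    then obtain k where k: "k \<in> D' c" "k \<in> D' d" by auto
    define S where "S = (\<Sum>j=1..n. k j * int (z j))"
    have "(\<Sum>j=1..n. k j * int ((z(l := e)) j)) = S" for e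
      unfolding S_def by (intro sum.cong) (auto simp: l_def)
    then have "int N dvd S + k l * int c" "int N dvd S + k l * int d"
      using k unfolding D'_def D_def l_def mem_dual_lattice_Suc by auto
    then have "int N dvd (S + k l * int c) - (S + k l * int d)" by (rule dvd_diff)
    also have "(S + k l * int c) - (S + k l * int d) = k l * (int c - int d)" by (simp add: algebra_simps)
    finally have "int N dvd k l \<or> int N dvd int c - int d"
      using assms by (subst (asm) prime_dvd_mult_iff) auto
    then have "int N dvd int c - int d" using k by (auto simp: D'_def)
    then have "int N \<le> \<bar>int c - int d\<bar>" using that by (intro zdvd_imp_le) auto
    then show False using that by auto
  qed
  have "(\<Sum>c=1..N-1. theta l N (z(l := c)) powr (1 / (2 * q))) \<le> (\<Sum>c=1..N-1. infsum f (D c))"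
    unfolding D_def f_def by (intro sum_mono theta_powr_le)
  also have "\<dots> \<le> (\<Sum>c=1..N-1. infsum f (D' c) + infsum f E)" by (intro sum_mono infD)
  also have "\<dots> = (\<Sum>c=1..N-1. infsum f (D' c)) + real (N - 1) * infsum f E" by (simp add: sum.distrib)
  finally have le: "(\<Sum>c=1..N-1. theta l N (z(l := c)) powr (1 / (2 * q)))
    \<le> (\<Sum>c=1..N-1. infsum f (D' c)) + real (N - 1) * infsum f E" .
  have hw: "((\<lambda>m. w (Suc n) m powr (1 / q)) has_sum g (Suc n)) (- {0})"
    by (intro has_sum_w_nonzero) simp
  have "(\<Sum>c=1..N-1. infsum f (D' c)) = infsum f (\<Union>c\<in>{1..N-1}. D' c)"
    using subD' disj by (intro sum_infsum summ) auto
  also have "\<dots> \<le> infsum f {k \<in> int_vecs l. k l \<in> - {0}}"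
  proof (intro infsum_mono2 summ)
    show "(\<Union>c\<in>{1..N-1}. D' c) \<subseteq> {k \<in> int_vecs l. k l \<in> - {0}}"
      using subD' by (auto simp: D'_def D_def)
  qed (use subD' f0 in auto)
  also have "\<dots> = T n * g l"
    unfolding f_def l_def using infsumI[OF has_sum_W_last[OF has_sum_imp_summable[OF hw]]] infsumI[OF hw] by simp
  finally have D'_le: "(\<Sum>c=1..N-1. infsum f (D' c)) \<le> T n * g l" .
  have "real (N - 1) * infsum f E \<le> real N * (g l * T n / real N)"
    using infE N f0 by (intro mult_mono infsum_nonneg) auto
  also have "\<dots> = T n * g l" using N by simp
  finally have "(\<Sum>c=1..N-1. theta l N (z(l := c)) powr (1 / (2 * q))) \<le> T n * g l + T n * g l"
    using le D'_le by linarith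
  also have "\<dots> = 2 * (g l * T n)" by simp
  finally show ?thesis unfolding l_def .
qed

lemma korobov_R_Suc: "korobov_R \<alpha> \<gamma> (Suc n) N z = korobov_R \<alpha> \<gamma> n N z + theta (Suc n) N z"
proof -
  define A where "A = {k \<in> dual_lattice (Suc n) N z - {zero_vec (Suc n)}. k (Suc n) = 0}"
  define B where "B = {k \<in> dual_lattice (Suc n) N z. k (Suc n) \<noteq> 0}"
  have AB: "dual_lattice (Suc n) N z - {zero_vec (Suc n)} = A \<union> B"
    by (auto simp: A_def B_def zero_vec_def)
  have "korobov_R \<alpha> \<gamma> (Suc n) N z = (\<Sum>\<^sub>\<infinity>k\<in>A. (W (Suc n) k)\<^sup>2) + (\<Sum>\<^sub>\<infinity>k\<in>B. (W (Suc n) k)\<^sup>2)"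
    unfolding korobov_R_def inverse_korobov_r_sq AB using dual_lattice_subset
    by (intro infsum_Un_disjoint summable_W_sq) (auto simp: A_def B_def)
  also have "(\<Sum>\<^sub>\<infinity>k\<in>A. (W (Suc n) k)\<^sup>2) = (\<Sum>\<^sub>\<infinity>k\<in>dual_lattice n N z - {zero_vec n}. (W n k)\<^sup>2)"
  \<comment> \<open>Vectors are extensional: dropping the last entry is \<open>restrict\<close>, and
    the inverse sets it to 0, where it contributes the factor 1 to W.\<close>
  proof (rule infsum_reindex_bij_witness[of _ "\<lambda>k. k(Suc n := 0)" "\<lambda>k. restrict k {1..n}"])
    fix k assume k: "k \<in> A"
    then have k': "k \<in> extensional {1..Suc n}" "k (Suc n) = 0" by (auto simp: A_def dual_lattice_def int_vecs_def PiE_def)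
    show ext: "(restrict k {1..n})(Suc n := 0) = k"
      using k' by (auto simp: fun_eq_iff extensional_def le_Suc_eq)
    have "restrict k {1..n} \<noteq> zero_vec n"
    proof
      assume "restrict k {1..n} = zero_vec n"
      then have "(zero_vec n)(Suc n := 0) = k" using ext by simp
      moreover have "(zero_vec n)(Suc n := 0) = zero_vec (Suc n)" by (auto simp: zero_vec_def fun_eq_iff)
      ultimately have "k = zero_vec (Suc n)" by simp
      then show False using k by (simp add: A_def)
    qed
    moreover have "int N dvd (\<Sum>j=1..n. k j * int (z j))"
      using k k' by (auto simp: A_def mem_dual_lattice_Suc)
    ultimately show "restrict k {1..n} \<in> dual_lattice n N z - {zero_vec n}"
      by (auto simp: dual_lattice_def int_vecs_def cong_0_iff)
    show "(W n (restrict k {1..n}))\<^sup>2 = (W (Suc n) k)\<^sup>2"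
      using k' by (simp add: W_def w_def)
  next
    fix k assume k: "k \<in> dual_lattice n N z - {zero_vec n}"
    then have ke: "k \<in> extensional {1..n}" by (auto simp: dual_lattice_def int_vecs_def PiE_def)
    show ext: "restrict (k(Suc n := 0)) {1..n} = k"
      using ke by (auto simp: fun_eq_iff extensional_def)
    have "k(Suc n := 0) \<noteq> zero_vec (Suc n)"
    proof
      assume "k(Suc n := 0) = zero_vec (Suc n)"
      then have "restrict (zero_vec (Suc n)) {1..n} = k" using ext by simp
      moreover have "restrict (zero_vec (Suc n)) {1..n} = zero_vec n" by (auto simp: zero_vec_def fun_eq_iff)
      ultimately have "k = zero_vec n" by simp
      then show False using k by simp
    qed
    then show "k(Suc n := 0) \<in> A"
      using k ke by (auto simp: A_def mem_dual_lattice_Suc) (auto simp: dual_lattice_def int_vecs_def cong_0_iff extensional_def)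
  qed
  finally show ?thesis unfolding B_def theta_def korobov_R_def inverse_korobov_r_sq .
qed

lemma korobov_R_0: "korobov_R \<alpha> \<gamma> 0 N z = 0"
proof -
  have *: "dual_lattice 0 N z - {zero_vec 0} = {}"
    by (auto simp: dual_lattice_def int_vecs_def zero_vec_def fun_eq_iff)
  show ?thesis unfolding korobov_R_def * by simp
qed

lemma korobov_R_nonneg: "korobov_R \<alpha> \<gamma> n N z \<ge> 0"
  unfolding korobov_R_def by (intro infsum_nonneg) auto

lemma korobov_R_cong: "(\<And>j. j \<in> {1..l} \<Longrightarrow> z j = z' j) \<Longrightarrow> korobov_R \<alpha> \<gamma> l N z = korobov_R \<alpha> \<gamma> l N z'"
  unfolding korobov_R_def using dual_lattice_cong[of l z z' N] by simp

lemma theta_cong: "(\<And>j. j \<in> {1..l} \<Longrightarrow> z j = z' j) \<Longrightarrow> theta l N z = theta l N z'"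
  unfolding theta_def using dual_lattice_cong[of l z z' N] by simp

text \<open>The candidates are ranked by R, but R differs from the increment only by a term
  independent of the last component. So the ranking is one by increments, and at least (1 -
  \<tau>)(N - 1) candidates are no better than c.\<close>

lemma theta_choice_le:
  assumes "prime N" "0 < \<tau>" "\<tau> < 1" "c \<in> cbc_choices \<alpha> \<gamma> \<tau> N (Suc n) z"
  shows "(1 - \<tau>) * real (N - 1) * theta (Suc n) N (z(Suc n := c)) powr (1 / (2 * q)) \<le> 2 * (g (Suc n) * T n)"
proof -
  define h where "h = (\<lambda>c. theta (Suc n) N (z(Suc n := c)))"
  have R: "korobov_R \<alpha> \<gamma> (Suc n) N (z(Suc n := d)) = korobov_R \<alpha> \<gamma> n N z + h d" for d
    unfolding korobov_R_Suc h_def using korobov_R_cong[of n "z(Suc n := d)" z] by simp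
  define t where "t = nat \<lceil>\<tau> * real (N - 1)\<rceil>"
  obtain S where S: "S \<subseteq> {1..<N}" "length [1..<N] + 1 \<le> card S + t" "\<And>d. d \<in> S \<Longrightarrow> h c \<le> h d"
  proof (rule sort_key_take_le)
    show "distinct [1..<N]" by simp
    show "c \<in> set (take t (sort_key (\<lambda>d. korobov_R \<alpha> \<gamma> n N z + h d) [1..<N]))"
      using assms(4) unfolding cbc_choices_def t_def R .
  qed auto
  have "0 \<le> \<tau> * real (N - 1)" using assms by simp
  then have "real t = of_int \<lceil>\<tau> * real (N - 1)\<rceil>" unfolding t_def by simp
  \<comment> \<open>Rounding up costs less than 1, which is offset by the extra 1 in the bound for
    \<open>card S\<close>.\<close>
  then have "real t < \<tau> * real (N - 1) + 1" by linarith
  moreover have "real (N - 1) + 1 \<le> real (card S) + real t" using of_nat_mono[OF S(2), where 'a = real] prime_ge_1_nat[OF assms(1)] by simp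
  ultimately have "(1 - \<tau>) * real (N - 1) \<le> real (card S)" by (simp add: algebra_simps)
  then have "(1 - \<tau>) * real (N - 1) * h c powr (1 / (2 * q)) \<le> real (card S) * h c powr (1 / (2 * q))"
    by (intro mult_right_mono) auto
  also have "\<dots> = (\<Sum>d\<in>S. h c powr (1 / (2 * q)))" by simp
  also have "\<dots> \<le> (\<Sum>d\<in>S. h d powr (1 / (2 * q)))"
    using S(3) q_gt theta_nonneg by (intro sum_mono powr_mono2) (auto simp: h_def)
  also have "\<dots> \<le> (\<Sum>d=1..N-1. h d powr (1 / (2 * q)))"
  proof (rule sum_mono2)
    show "S \<subseteq> {1..N-1}" using S(1) by fastforce
  qed auto
  also have "\<dots> \<le> 2 * (g (Suc n) * T n)" unfolding h_def by (rule sum_theta_le[OF assms(1)])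
  finally show ?thesis unfolding h_def .
qed

end

subsection \<open>Counting generating vectors\<close>

text \<open>The product of the primes in S divides n, and each is at least 2. The induction splits
  off one prime; the others divide the cofactor.\<close>

lemma two_power_card_primes_le:
  fixes n :: nat
  assumes "finite S" "\<And>p. p \<in> S \<Longrightarrow> prime p \<and> p dvd n" "n > 0"
  shows "2 ^ card S \<le> n"
  using assms
proof (induction S arbitrary: n rule: finite_induct)
  case (insert p S)
  have p: "prime p" "p dvd n" using insert.prems(1)[of p] by auto
  obtain m where m: "n = p * m" using p(2) by auto
  have "2 ^ card S \<le> m"
  proof (rule insert.IH)
    fix r assume r: "r \<in> S"
    then have r': "prime r" "r dvd n" using insert.prems(1)[of r] by auto
    have "r \<noteq> p" using r insert.hyps by auto
    then have "\<not> r dvd p" using r' p primes_dvd_imp_eq by blast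
    then show "prime r \<and> r dvd m" using r' m prime_dvd_mult_iff[of r p m] by auto
  next
    show "m > 0" using insert.prems(2) m by (cases m) auto
  qed
  then have "2 * 2 ^ card S \<le> p * m" using prime_ge_2_nat[OF p(1)] by (intro mult_mono) auto
  then show ?case using insert.hyps m by simp
qed auto

lemma cbc_choices_subset: "cbc_choices \<alpha> \<gamma> \<tau> N l z \<subseteq> {1..<N}"
  unfolding cbc_choices_def using set_take_subset by fastforce

lemma card_cbc_choices:
  assumes "0 < \<tau>" "\<tau> < 1"
  shows "card (cbc_choices \<alpha> \<gamma> \<tau> N l z) = nat \<lceil>\<tau> * real (N - 1)\<rceil>"
proof -
  have "\<tau> * real (N - 1) \<le> 1 * real (N - 1)" using assms by (intro mult_right_mono) auto
  then have "nat \<lceil>\<tau> * real (N - 1)\<rceil> \<le> N - 1" by (simp add: nat_le_iff ceiling_le_iff)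
  then show ?thesis unfolding cbc_choices_def by (subst distinct_card) auto
qed

lemma finite_cbc_vectors: "finite (cbc_vectors \<alpha> \<gamma> \<tau> s N)"
  by (rule finite_subset[of _ "{1..s} \<rightarrow>\<^sub>E {1..N - 1}"]) (auto simp: cbc_vectors_def intro: finite_PiE)

text \<open>The number of choices does not depend on z (\<open>card_cbc_choices\<close>), so all
  fibres over the shorter vectors have equal size: uniform sampling of whole vectors agrees with
  successive uniform choices.\<close>

lemma cbc_vectors_Suc:
  assumes "n \<ge> 1"
  shows "bij_betw (\<lambda>(z, c). z(Suc n := c))
    (SIGMA z:cbc_vectors \<alpha> \<gamma> \<tau> n N. cbc_choices \<alpha> \<gamma> \<tau> N (Suc n) z) (cbc_vectors \<alpha> \<gamma> \<tau> (Suc n) N)"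
proof (rule bij_betw_byWitness[where f' = "\<lambda>z. (restrict z {1..n}, z (Suc n))"])
  have restr: "restrict (restrict z {1..n}) {1..l - 1} = restrict z {1..l - 1}" if "l \<le> n" for l and z :: "nat \<Rightarrow> nat"
    using that by (auto simp: fun_eq_iff)
  have upd: "restrict (z(Suc n := c)) {1..n} = z" if "z \<in> extensional {1..n}" for z :: "nat \<Rightarrow> nat" and c
    using that by (auto simp: fun_eq_iff extensional_def)
  have restr': "restrict (z(Suc n := c)) {1..l - 1} = restrict z {1..l - 1}" if "l \<le> n" for l c and z :: "nat \<Rightarrow> nat"
    using that by (auto simp: fun_eq_iff)
  let ?V = "cbc_vectors \<alpha> \<gamma> \<tau>" and ?c = "cbc_choices \<alpha> \<gamma> \<tau> N"
  have ext: "z \<in> extensional {1..m}" if "z \<in> ?V m N" for z m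
    using that by (auto simp: cbc_vectors_def PiE_def)
  show "\<forall>a\<in>SIGMA z:?V n N. ?c (Suc n) z. (restrict (case a of (z, c) \<Rightarrow> z(Suc n := c)) {1..n}, (case a of (z, c) \<Rightarrow> z(Suc n := c)) (Suc n)) = a"
    using ext upd by auto
  show "\<forall>z\<in>?V (Suc n) N. (case (restrict z {1..n}, z (Suc n)) of (z, c) \<Rightarrow> z(Suc n := c)) = z"
  proof
    fix z assume "z \<in> ?V (Suc n) N"
    from ext[OF this] show "(case (restrict z {1..n}, z (Suc n)) of (z, c) \<Rightarrow> z(Suc n := c)) = z"
      by (auto simp: fun_eq_iff extensional_def le_Suc_eq)
  qed
  show "(\<lambda>(z, c). z(Suc n := c)) ` (SIGMA z:?V n N. ?c (Suc n) z) \<subseteq> ?V (Suc n) N"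
  proof clarify
    fix z c assume z: "z \<in> ?V n N" and c: "c \<in> ?c (Suc n) z"
    have zz: "z \<in> {1..n} \<rightarrow>\<^sub>E {1..N - 1}" "z 1 = 1" "\<And>l. l \<in> {2..n} \<Longrightarrow> z l \<in> ?c l (restrict z {1..l - 1})"
      using z by (auto simp: cbc_vectors_def)
    have "c \<in> {1..<N}" using c cbc_choices_subset by blast
    then have "z(Suc n := c) \<in> {1..Suc n} \<rightarrow>\<^sub>E {1..N - 1}"
      using zz(1) by (auto simp: PiE_def Pi_def extensional_def)
    moreover have "(z(Suc n := c)) l \<in> ?c l (restrict (z(Suc n := c)) {1..l - 1})" if "l \<in> {2..Suc n}" for l
    proof (cases "l = Suc n")
      case True
      then show ?thesis using c upd[OF ext[OF z]] by simp
    next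
      case False
      then have "l \<in> {2..n}" using that by auto
      then show ?thesis using zz(3)[of l] False restr'[of l z c] by simp
    qed
    ultimately show "z(Suc n := c) \<in> ?V (Suc n) N" using zz(2) assms by (simp add: cbc_vectors_def)
  qed
  show "(\<lambda>z. (restrict z {1..n}, z (Suc n))) ` ?V (Suc n) N \<subseteq> (SIGMA z:?V n N. ?c (Suc n) z)"
  proof clarify
    fix z assume z: "z \<in> ?V (Suc n) N"
    have zz: "z \<in> {1..Suc n} \<rightarrow>\<^sub>E {1..N - 1}" "z 1 = 1" "\<And>l. l \<in> {2..Suc n} \<Longrightarrow> z l \<in> ?c l (restrict z {1..l - 1})"
      using z by (auto simp: cbc_vectors_def)
    have "restrict z {1..n} \<in> ?V n N"
      unfolding cbc_vectors_def
    proof (intro CollectI conjI ballI)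
      show "restrict z {1..n} \<in> {1..n} \<rightarrow>\<^sub>E {1..N - 1}" using zz(1) by (auto simp: PiE_def Pi_def)
      show "restrict z {1..n} 1 = 1" using zz(2) assms by simp
      fix l assume l: "l \<in> {2..n}"
      then show "restrict z {1..n} l \<in> ?c l (restrict (restrict z {1..n}) {1..l - 1})"
        using zz(3)[of l] restr[of l z] by simp
    qed
    moreover have "z (Suc n) \<in> ?c (Suc n) (restrict z {1..n})" using zz(3)[of "Suc n"] assms by simp
    ultimately show "restrict z {1..n} \<in> ?V n N \<and> z (Suc n) \<in> ?c (Suc n) (restrict z {1..n})" by simp
  qed
qed

text \<open>Induction removes the last component. If N does not divide its k, each shorter vector
  has at most one dual extension among t. If N divides it, the last component does not affect
  duality, both counts are multiplied by t, and the induction hypothesis applies.\<close>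

lemma card_dual_cbc_vectors_le:
  fixes k :: "nat \<Rightarrow> int"
  assumes "prime N" "0 < \<tau>" "\<tau> < 1" "n \<ge> 1" "\<exists>j\<in>{1..n}. \<not> int N dvd k j"
  shows "card {z \<in> cbc_vectors \<alpha> \<gamma> \<tau> n N. int N dvd (\<Sum>j=1..n. k j * int (z j))} * nat \<lceil>\<tau> * real (N - 1)\<rceil>
    \<le> card (cbc_vectors \<alpha> \<gamma> \<tau> n N)"
  using assms(4,5)
proof (induction n rule: nat_induct_at_least)
  case base
  \<comment> \<open>As z 1 = 1, the sum is k 1 itself, which N does not divide.\<close>
  have eq: "{z \<in> cbc_vectors \<alpha> \<gamma> \<tau> 1 N. int N dvd (\<Sum>j=1..1. k j * int (z j))} = {}"
    using base by (auto simp: cbc_vectors_def)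
  show ?case unfolding eq by simp
next
  case (Suc n)
  define t where "t = nat \<lceil>\<tau> * real (N - 1)\<rceil>"
  define V where "V = (\<lambda>n. cbc_vectors \<alpha> \<gamma> \<tau> n N)"
  define c where "c = cbc_choices \<alpha> \<gamma> \<tau> N (Suc n)"
  define S where "S = (\<lambda>z :: nat \<Rightarrow> nat. \<Sum>j=1..n. k j * int (z j))"
  define C where "C = (\<lambda>z. {d \<in> c z. int N dvd S z + k (Suc n) * int d})"
  have fin: "finite (V n)" "finite (c z)" "finite (C z)" for z
    using cbc_choices_subset[of \<alpha> \<gamma> \<tau> N "Suc n" z] finite_cbc_vectors
    by (auto simp: V_def c_def C_def intro: finite_subset)
  have card_c: "card (c z) = t" for z unfolding c_def t_def using assms by (intro card_cbc_choices)
  have bij: "bij_betw (\<lambda>(z, d). z(Suc n := d)) (SIGMA z:V n. c z) (V (Suc n))"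
    unfolding V_def c_def using Suc.hyps by (rule cbc_vectors_Suc)
  have cardV: "card (V (Suc n)) = card (V n) * t"
    using bij_betw_same_card[OF bij] fin card_c by (simp add: card_SigmaI)
  have S: "(\<Sum>j=1..Suc n. k j * int ((z(Suc n := d)) j)) = S z + k (Suc n) * int d" for z d
    by (simp add: S_def)
  have "{z \<in> V (Suc n). int N dvd (\<Sum>j=1..Suc n. k j * int (z j))} = (\<lambda>(z, d). z(Suc n := d)) ` (SIGMA z:V n. C z)"
  proof -
    have "{z \<in> V (Suc n). int N dvd (\<Sum>j=1..Suc n. k j * int (z j))} = (\<lambda>(z, d). z(Suc n := d)) `
        {x \<in> SIGMA z:V n. c z. int N dvd (\<Sum>j=1..Suc n. k j * int ((case x of (z, d) \<Rightarrow> z(Suc n := d)) j))}"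
      unfolding bij_betw_imp_surj_on[OF bij, symmetric] by auto
    also have "{x \<in> SIGMA z:V n. c z. int N dvd (\<Sum>j=1..Suc n. k j * int ((case x of (z, d) \<Rightarrow> z(Suc n := d)) j))} =
        (SIGMA z:V n. C z)"
      unfolding C_def S[symmetric] by (auto simp del: sum.cl_ivl_Suc)
    finally show ?thesis .
  qed
  also have "card \<dots> = card (SIGMA z:V n. C z)"
    by (intro card_image inj_on_subset[OF bij_betw_imp_inj_on[OF bij]]) (auto simp: C_def)
  also have "\<dots> = (\<Sum>z\<in>V n. card (C z))" using fin by (simp add: card_SigmaI)
  finally have cardB: "card {z \<in> V (Suc n). int N dvd (\<Sum>j=1..Suc n. k j * int (z j))} = (\<Sum>z\<in>V n. card (C z))" .
  have "(\<Sum>z\<in>V n. card (C z)) * t \<le> card (V n) * t"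
  proof (cases "int N dvd k (Suc n)")
    case False
    have "card (C z) \<le> 1" for z
    proof -
      have "d = e" if "d \<in> C z" "e \<in> C z" for d e
      proof (rule ccontr)
        assume "d \<noteq> e"
        have "int N dvd (S z + k (Suc n) * int d) - (S z + k (Suc n) * int e)"
          using that by (intro dvd_diff) (auto simp: C_def)
        also have "\<dots> = k (Suc n) * (int d - int e)" by (simp add: algebra_simps)
        finally have "int N dvd int d - int e"
          using assms(1) False by (subst (asm) prime_dvd_mult_iff) auto
        then have "int N \<le> \<bar>int d - int e\<bar>" using \<open>d \<noteq> e\<close> by (intro zdvd_imp_le) auto
        moreover have "d < N" "e < N"
          using that cbc_choices_subset[of \<alpha> \<gamma> \<tau> N "Suc n" z] by (auto simp: C_def c_def)
        ultimately show False by auto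
      qed
      then have "C z \<subseteq> {d}" if "d \<in> C z" for d using that by blast
      then show ?thesis using card_mono[of "{d}" "C z" for d] by (cases "C z = {}") fastforce+
    qed
    then have "(\<Sum>z\<in>V n. card (C z)) \<le> card (V n)" using sum_bounded_above[of "V n" "\<lambda>z. card (C z)" 1] by simp
    then show ?thesis by simp
  next
    case True
    then have "int N dvd S z + k (Suc n) * int d \<longleftrightarrow> int N dvd S z" for z d
      by (intro dvd_add_left_iff) simp
    then have "card (C z) = (if int N dvd S z then t else 0)" for z
      using card_c by (simp add: C_def)
    then have "(\<Sum>z\<in>V n. card (C z)) = card {z \<in> V n. int N dvd S z} * t"
      using fin by (simp add: sum.If_cases Int_def)
    moreover have "card {z \<in> V n. int N dvd S z} * t \<le> card (V n)"
    proof -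
      have "\<exists>j\<in>{1..n}. \<not> int N dvd k j" using Suc.prems True by (auto simp: le_Suc_eq)
      then show ?thesis using Suc.IH unfolding V_def S_def t_def by simp
    qed
    ultimately show ?thesis by simp
  qed
  then show ?case using cardB cardV unfolding V_def t_def by simp
qed

lemma prob_dual_le:
  fixes k :: "nat \<Rightarrow> int"
  assumes "prime N" "0 < \<tau>" "\<tau> < 1" "s \<ge> 1" "M \<ge> 1" "real M / 2 \<le> real N" "k \<in> int_vecs s"
  shows "(1 / real (card (cbc_vectors \<alpha> \<gamma> \<tau> s N))) * (\<Sum>z\<in>cbc_vectors \<alpha> \<gamma> \<tau> s N. of_bool (k \<in> dual_lattice s N z))
    \<le> 4 / (\<tau> * real M) + of_bool (\<forall>j\<in>{1..s}. int N dvd k j)"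
proof -
  define V where "V = cbc_vectors \<alpha> \<gamma> \<tau> s N"
  define B where "B = {z \<in> V. int N dvd (\<Sum>j=1..s. k j * int (z j))}"
  define t where "t = nat \<lceil>\<tau> * real (N - 1)\<rceil>"
  have fin: "finite V" by (simp add: V_def finite_cbc_vectors)
  have sum_eq: "(\<Sum>z\<in>V. of_bool (k \<in> dual_lattice s N z)) = real (card B)"
    using assms(7) fin by (simp add: B_def dual_lattice_def cong_0_iff sum_of_bool_eq Int_def)
  have "real (card B) / real (card V) \<le> 4 / (\<tau> * real M) + of_bool (\<forall>j\<in>{1..s}. int N dvd k j)"
  proof (cases "\<forall>j\<in>{1..s}. int N dvd k j")
    case True
    have "card B \<le> card V" using fin by (intro card_mono) (auto simp: B_def)
    then have "real (card B) / real (card V) \<le> 1" by (cases "card V = 0") (auto simp: divide_le_eq_1)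
    also have "\<dots> \<le> 4 / (\<tau> * real M) + 1" using assms by simp
    finally show ?thesis using True by simp
  next
    case False
    then have le: "card B * t \<le> card V"
      unfolding B_def V_def t_def using assms by (intro card_dual_cbc_vectors_le) auto
    have N: "N \<ge> 2" using assms(1) by (rule prime_ge_2_nat)
    \<comment> \<open>From N >= 2 follows N - 1 >= N/2 >= M/4, the origin of the constant 4.\<close>
    have "real M / 4 \<le> real (N - 1)" using N assms(6) by (simp add: of_nat_diff)
    then have "\<tau> * (real M / 4) \<le> \<tau> * real (N - 1)" using assms(2) by (intro mult_left_mono) auto
    then have "\<tau> * real M / 4 \<le> \<tau> * real (N - 1)" by simp
    also have "\<dots> \<le> real t" unfolding t_def by (rule of_nat_ceiling)
    finally have t: "\<tau> * real M / 4 \<le> real t" .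
    show ?thesis
    proof (cases "card V = 0")
      case True
      then show ?thesis using assms(2) by simp
    next
      case ne: False
      have pos: "\<tau> * real M > 0" using ne assms by simp
      have "real (card B) * (\<tau> * real M / 4) \<le> real (card B) * real t" using t by (intro mult_left_mono) auto
      also have "\<dots> \<le> real (card V)" using le by (simp flip: of_nat_mult)
      finally have "real (card B) / real (card V) \<le> 4 / (\<tau> * real M)" using ne pos by (simp add: field_simps)
      then show ?thesis using False by simp
    qed
  qed
  then show ?thesis using sum_eq by (simp add: V_def)
qed

subsection \<open>Error of a lattice rule\<close>

lemma has_sum_sum:
  fixes f :: "'a \<Rightarrow> 'b \<Rightarrow> 'c :: {topological_comm_monoid_add}"
  assumes "\<And>i. i \<in> I \<Longrightarrow> (f i has_sum S i) A"
  shows "((\<lambda>x. \<Sum>i\<in>I. f i x) has_sum (\<Sum>i\<in>I. S i)) A"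
  using assms by (induction I rule: infinite_finite_induct) (auto intro!: has_sum_add)

lemma fourier_coeff_zero: "fourier_coeff s f (zero_vec s) = complex_of_real (cube_integral s f)"
proof -
  have "fourier_char s (zero_vec s) x = 1" for x by (simp add: fourier_char_def zero_vec_def)
  then have "fourier_coeff s f (zero_vec s) =
      (LINT x|lborel_vec s. complex_of_real (indicat_real (unit_cube s) x *\<^sub>R f x))"
    unfolding fourier_coeff_def set_lebesgue_integral_def by (simp add: scaleR_conv_of_real)
  then show ?thesis unfolding cube_integral_def set_lebesgue_integral_def
    by (simp only: integral_complex_of_real)
qed

lemma lattice_point_unit_cube: "lattice_point s N z n \<in> unit_cube s"
  by (auto simp: lattice_point_def unit_cube_def frac_lt_1)

text \<open>Taking fractional parts changes the phase only by an integer multiple of 2 pi.\<close>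

lemma fourier_char_lattice_point:
  assumes "N \<ge> 1"
  shows "fourier_char s k (lattice_point s N z n) =
    cis (2 * pi * (of_int (\<Sum>j=1..s. k j * int (z j)) / real N)) ^ n"
proof -
  define S where "S = (\<Sum>j=1..s. k j * int (z j))"
  define m where "m = (\<Sum>j=1..s. k j * \<lfloor>real n * real (z j) / real N\<rfloor>)"
  have "(\<Sum>j=1..s. real_of_int (k j) * lattice_point s N z n j) =
      (\<Sum>j=1..s. real n * (of_int (k j * int (z j)) / real N) - of_int (k j * \<lfloor>real n * real (z j) / real N\<rfloor>))"
    by (intro sum.cong) (auto simp: lattice_point_def frac_def algebra_simps)
  also have "\<dots> = real n * (of_int S / real N) - of_int m"
    by (simp add: sum_subtractf S_def m_def sum_distrib_left sum_divide_distrib)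
  finally have *: "(\<Sum>j=1..s. real_of_int (k j) * lattice_point s N z n j) = real n * (of_int S / real N) - of_int m" .
  have "fourier_char s k (lattice_point s N z n) =
      cis (real n * (2 * pi * (of_int S / real N)) - 2 * pi * of_int m)"
    unfolding fourier_char_def * right_diff_distrib by (simp only: mult_ac)
  also have "\<dots> = cis (real n * (2 * pi * (of_int S / real N))) / cis (2 * pi * of_int m)"
    by (rule cis_divide[symmetric])
  also have "\<dots> = cis (2 * pi * (of_int S / real N)) ^ n"
    by (simp only: cis_multiple_2pi Ints_of_int div_by_1 Complex.DeMoivre)
  finally show ?thesis unfolding S_def .
qed

text \<open>Orthogonality of characters: if N does not divide S, the base is an N-th root of unity
  other than 1 and the geometric sum vanishes.\<close>

lemma sum_cis_multiples:
  assumes "N \<ge> 1"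
  shows "(\<Sum>n<N. cis (2 * pi * (of_int S / real N)) ^ n) = (if int N dvd S then of_nat N else 0)"
proof (cases "int N dvd S")
  case True
  then obtain m where "S = int N * m" by auto
  then have "of_int S / real N = of_int m" using assms by simp
  then have "cis (2 * pi * (of_int S / real N)) = 1" by (simp only: cis_multiple_2pi Ints_of_int)
  then show ?thesis using True by simp
next
  case False
  define u where "u = cis (2 * pi * (of_int S / real N))"
  have "u \<noteq> 1"
  proof
    assume "u = 1"
    then have "cos (2 * pi * (of_int S / real N)) = 1" by (simp add: u_def complex_eq_iff)
    then obtain m :: int where "2 * pi * (of_int S / real N) = of_int m * 2 * pi"
      using cos_one_2pi_int by auto
    then have "of_int S = real_of_int (m * int N)" using assms by (simp add: field_simps)
    then have "S = m * int N" by (simp only: of_int_eq_iff)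
    then show False using False by simp
  qed
  moreover have "real N * (2 * pi * (of_int S / real N)) = 2 * pi * of_int S" using assms by simp
  then have "u ^ N = 1" by (simp only: u_def Complex.DeMoivre cis_multiple_2pi Ints_of_int)
  ultimately have "(\<Sum>n<N. u ^ n) = 0" by (simp add: geometric_sum)
  then show ?thesis using False by (simp add: u_def)
qed

text \<open>Membership in the dual lattice is kept as a factor, not as the index set: with a common
  index set the sums can be averaged over N and z term by term.\<close>

lemma lattice_error_le:
  assumes f: "f \<in> korobov_space s \<alpha> \<gamma>" and N: "N \<ge> 1"
  shows "\<bar>lattice_rule s N z f - cube_integral s f\<bar> \<le>
    (\<Sum>\<^sub>\<infinity>k\<in>int_vecs s - {zero_vec s}. norm (fourier_coeff s f k) * of_bool (k \<in> dual_lattice s N z))"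
proof -
  define c where "c = fourier_coeff s f"
  define h where "h = (\<lambda>k. c k * of_bool (k \<in> dual_lattice s N z))"
  define A where "A = int_vecs s - {zero_vec s}"
  have abs: "(\<lambda>k. norm (c k)) summable_on int_vecs s"
    using f by (simp add: korobov_space_def c_def)
  have zero_mem: "zero_vec s \<in> int_vecs s" by (simp add: zero_vec_def int_vecs_def)
  \<comment> \<open>The expansion holds at every point of the cube, not just almost everywhere, so
    it may be evaluated at lattice points.\<close>
  have "((\<lambda>k. c k * fourier_char s k x) has_sum complex_of_real (f x)) (int_vecs s)" if "x \<in> unit_cube s" for x
    using f that by (simp add: korobov_space_def c_def)
  then have "((\<lambda>k. \<Sum>n<N. c k * fourier_char s k (lattice_point s N z n)) has_sum
      (\<Sum>n<N. complex_of_real (f (lattice_point s N z n)))) (int_vecs s)"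
    using lattice_point_unit_cube by (intro has_sum_sum) auto
  then have "((\<lambda>k. (1 / of_nat N) * (\<Sum>n<N. c k * fourier_char s k (lattice_point s N z n))) has_sum
      (1 / of_nat N) * (\<Sum>n<N. complex_of_real (f (lattice_point s N z n)))) (int_vecs s)"
    by (rule has_sum_cmult_right)
  also have "(1 / of_nat N) * (\<Sum>n<N. complex_of_real (f (lattice_point s N z n))) = complex_of_real (lattice_rule s N z f)"
    by (simp add: lattice_rule_def)
  also have "(((\<lambda>k. (1 / of_nat N) * (\<Sum>n<N. c k * fourier_char s k (lattice_point s N z n))) has_sum
       complex_of_real (lattice_rule s N z f)) (int_vecs s)) \<longleftrightarrow>
      ((h has_sum complex_of_real (lattice_rule s N z f)) (int_vecs s))"
  proof (rule has_sum_cong)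
    fix k assume k: "k \<in> int_vecs s"
    have "(\<Sum>n<N. c k * fourier_char s k (lattice_point s N z n)) = c k * (\<Sum>n<N. cis (2 * pi * (of_int (\<Sum>j=1..s. k j * int (z j)) / real N)) ^ n)"
      unfolding fourier_char_lattice_point[OF N] by (rule sum_distrib_left[symmetric])
    then show "(1 / of_nat N) * (\<Sum>n<N. c k * fourier_char s k (lattice_point s N z n)) = h k"
      unfolding sum_cis_multiples[OF N] using N k by (auto simp: h_def dual_lattice_def cong_0_iff)
  qed
  finally have h: "(h has_sum complex_of_real (lattice_rule s N z f)) (int_vecs s)" .
  have absA: "(\<lambda>k. norm (h k)) summable_on A"
    by (rule summable_on_comparison_test[OF summable_on_subset_banach[OF abs, of A]]) (auto simp: h_def A_def)
  have "insert (zero_vec s) A = int_vecs s" using zero_mem by (auto simp: A_def)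
  then have "complex_of_real (lattice_rule s N z f) = infsum h (insert (zero_vec s) A)" using infsumI[OF h] by simp
  also have "\<dots> = h (zero_vec s) + infsum h A"
    by (rule infsum_insert[OF abs_summable_summable[OF absA]]) (simp add: A_def)
  also have "h (zero_vec s) = complex_of_real (cube_integral s f)"
    using zero_mem by (simp add: h_def c_def fourier_coeff_zero dual_lattice_def) (simp add: zero_vec_def)
  finally have eq: "complex_of_real (lattice_rule s N z f - cube_integral s f) = infsum h A" by simp
  have "\<bar>lattice_rule s N z f - cube_integral s f\<bar> = norm (complex_of_real (lattice_rule s N z f - cube_integral s f))"
    by (rule norm_of_real[symmetric])
  also have "\<dots> = norm (infsum h A)" by (simp only: eq)
  also have "\<dots> \<le> (\<Sum>\<^sub>\<infinity>k\<in>A. norm (h k))" using absA by (rule norm_infsum_bound)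
  also have "\<dots> = (\<Sum>\<^sub>\<infinity>k\<in>A. norm (c k) * of_bool (k \<in> dual_lattice s N z))"
    by (rule infsum_cong) (simp add: h_def norm_mult)
  finally show ?thesis unfolding A_def c_def .
qed

subsection \<open>The randomized error\<close>

text \<open>The bound B >= 0 covers the empty set, whose average is 0 by division by zero.\<close>

lemma average_le:
  fixes f :: "'a \<Rightarrow> real"
  assumes "\<And>x. x \<in> A \<Longrightarrow> f x \<le> B" "0 \<le> B"
  shows "(1 / real (card A)) * (\<Sum>x\<in>A. f x) \<le> B"
proof (cases "card A = 0")
  case False
  have "(\<Sum>x\<in>A. f x) \<le> real (card A) * B" using assms(1) by (rule sum_bounded_above)
  then show ?thesis using False by (simp add: divide_le_eq mult.commute)
qed (use assms in simp)

context korobov_weights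
begin

text \<open>The estimate 1 + x <= exp x turns the product into the exponential of a partial sum of a
  convergent series, which makes the final constant independent of s.\<close>

lemma T_bounded:
  assumes "summable (\<lambda>j. \<gamma> (Suc j) powr (1 / q))"
  shows "\<exists>C\<ge>1. \<forall>s. T s \<le> C"
proof (intro exI conjI allI)
  define S where "S = (\<Sum>j. \<gamma> (Suc j) powr (1 / q))"
  have S: "(\<Sum>j<s. \<gamma> (Suc j) powr (1 / q)) \<le> S" for s
    unfolding S_def using assms by (intro sum_le_suminf) auto
  then have "S \<ge> 0" using S[of 0] by simp
  then show "1 \<le> exp (S * Z)" using Z_nonneg by simp
  fix s
  have "T s \<le> (\<Prod>j=1..s. exp (g j))"
    unfolding T_def using g_nonneg exp_ge_add_one_self by (intro prod_mono) (auto intro: add_nonneg_nonneg)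
  also have "\<dots> = exp (\<Sum>j=1..s. g j)" by (simp add: exp_sum)
  also have "(\<Sum>j=1..s. g j) = (\<Sum>j<s. \<gamma> (Suc j) powr (1 / q)) * Z"
  proof -
    have "(\<Sum>j=1..s. g j) = (\<Sum>j<s. g (Suc j))"
      by (rule sum.reindex_bij_witness[of _ Suc "\<lambda>j. j - 1"]) auto
    then show ?thesis by (simp add: g_def sum_distrib_right)
  qed
  also have "exp ((\<Sum>j<s. \<gamma> (Suc j) powr (1 / q)) * Z) \<le> exp (S * Z)"
    using S[of s] Z_nonneg by (simp add: mult_right_mono)
  finally show "T s \<le> exp (S * Z)" .
qed

text \<open>The first component is fixed to 1, but by primality of \<open>N\<close> all choices in
  \<open>{1..N-1}\<close> are equally good for it.\<close>
lemma theta_first_le: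
  assumes "prime N" "z 1 = 1"
  shows "real (N - 1) * theta 1 N z powr (1 / (2 * q)) \<le> 2 * (g 1 * T 0)"
proof -
  have eq: "theta 1 N (z(1 := c)) = theta 1 N z" if c: "c \<in> {1..N-1}" for c
  proof -
    have "\<not> N dvd c" using c dvd_imp_le[of N c] prime_ge_2_nat[OF assms(1)] by auto
    then have "\<not> int N dvd int c" by simp
    then have "int N dvd k 1 * int c \<longleftrightarrow> int N dvd k 1" for k :: "nat \<Rightarrow> int"
      using assms(1) by (subst prime_dvd_mult_iff) auto
    then have "dual_lattice 1 N (z(1 := c)) = dual_lattice 1 N z"
      using assms(2) by (auto simp: dual_lattice_def cong_0_iff)
    then show ?thesis by (simp add: theta_def)
  qed
  have "real (N - 1) * theta 1 N z powr (1 / (2 * q)) = (\<Sum>c=1..N-1. theta 1 N (z(1 := c)) powr (1 / (2 * q)))"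
    using eq by simp
  also have "\<dots> \<le> 2 * (g 1 * T 0)" using sum_theta_le[OF assms(1), of 0 z] by simp
  finally show ?thesis .
qed

text \<open>By subadditivity the powers of the increments add up, and their bounds telescope:
  \<open>g (Suc n) * T n\<close> is T (Suc n) - T n.\<close>

lemma korobov_R_cbc_le:
  assumes "prime N" "0 < \<tau>" "\<tau> < 1" "z \<in> cbc_vectors \<alpha> \<gamma> \<tau> s N"
  shows "korobov_R \<alpha> \<gamma> s N z \<le> (2 / ((1 - \<tau>) * real (N - 1)) * T s) powr (2 * q)"
proof -
  define p where "p = 1 / (2 * q)"
  define K where "K = 2 / ((1 - \<tau>) * real (N - 1))"
  have p: "0 < p" "p \<le> 1" using q_gt by (auto simp: p_def)
  have N: "N \<ge> 2" using assms(1) by (rule prime_ge_2_nat)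
  have pos: "(1 - \<tau>) * real (N - 1) > 0" using N assms by simp
  have K0: "K \<ge> 0" unfolding K_def by (rule divide_nonneg_pos[OF _ pos]) simp
  have theta: "theta (Suc n) N z powr p \<le> K * (g (Suc n) * T n)" if "Suc n \<le> s" for n
  proof -
    have "(1 - \<tau>) * real (N - 1) * theta (Suc n) N z powr p \<le> 2 * (g (Suc n) * T n)"
    proof (cases "n = 0")
      case True
      have z1: "z 1 = 1" using assms(4) by (simp add: cbc_vectors_def)
      \<comment> \<open>For the fixed first component the bound holds without 1 - \<tau>; the factor
        is inserted so that all components share K.\<close>
      have "(1 - \<tau>) * (real (N - 1) * theta 1 N z powr p) \<le> 1 * (real (N - 1) * theta 1 N z powr p)"
        using assms by (intro mult_right_mono) auto
      also have "\<dots> \<le> 2 * (g 1 * T 0)" using theta_first_le[of N z, OF assms(1) z1] by (simp add: p_def)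
      finally show ?thesis using True by (simp add: mult.assoc)
    next
      case False
      have c: "z (Suc n) \<in> cbc_choices \<alpha> \<gamma> \<tau> N (Suc n) (restrict z {1..n})"
      proof -
        have "\<forall>l\<in>{2..s}. z l \<in> cbc_choices \<alpha> \<gamma> \<tau> N l (restrict z {1..l - 1})"
          using assms(4) by (simp add: cbc_vectors_def)
        moreover have "Suc n \<in> {2..s}" using that False by simp
        ultimately show ?thesis by fastforce
      qed
      have "theta (Suc n) N ((restrict z {1..n})(Suc n := z (Suc n))) = theta (Suc n) N z"
        by (rule theta_cong) auto
      then show ?thesis using theta_choice_le[OF assms(1-3) c] by (simp add: p_def)
    qed
    then show ?thesis using pos unfolding K_def times_divide_eq_left pos_le_divide_eq[OF pos] by (simp only: mult_ac)
  qed
  have "korobov_R \<alpha> \<gamma> n N z powr p \<le> K * (T n - 1)" if "n \<le> s" for n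
    using that
  proof (induction n)
    case 0
    then show ?case by (simp add: korobov_R_0 T_def)
  next
    case (Suc n)
    have "korobov_R \<alpha> \<gamma> (Suc n) N z powr p \<le> korobov_R \<alpha> \<gamma> n N z powr p + theta (Suc n) N z powr p"
      unfolding korobov_R_Suc by (intro powr_add_le korobov_R_nonneg theta_nonneg p)
    also have "\<dots> \<le> K * (T n - 1) + K * (g (Suc n) * T n)"
      using Suc theta[of n] by (intro add_mono) auto
    also have "\<dots> = K * (T (Suc n) - 1)" by (simp add: T_Suc algebra_simps)
    finally show ?case .
  qed
  from this[of s] have "korobov_R \<alpha> \<gamma> s N z powr p \<le> K * (T s - 1)" by simp
  also have "\<dots> \<le> K * T s" using K0 by (intro mult_left_mono) auto
  finally have "(korobov_R \<alpha> \<gamma> s N z powr p) powr (2 * q) \<le> (K * T s) powr (2 * q)"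
    using q_gt by (intro powr_mono2) auto
  then show ?thesis using q_gt korobov_R_nonneg by (simp add: powr_powr p_def K_def)
qed

section \<open>Probability that a frequency lies in the random dual lattice\<close>

definition dual_prob :: "real \<Rightarrow> nat \<Rightarrow> nat \<Rightarrow> (nat \<Rightarrow> int) \<Rightarrow> real"
  where "dual_prob \<tau> M s k = (1 / real (card (primes_half_upto M))) *
    (\<Sum>N\<in>primes_half_upto M. (1 / real (card (cbc_vectors \<alpha> \<gamma> \<tau> s N))) *
      (\<Sum>z\<in>cbc_vectors \<alpha> \<gamma> \<tau> s N. of_bool (k \<in> dual_lattice s N z)))"

lemma dual_prob_nonneg: "0 \<le> dual_prob \<tau> M s k"
  unfolding dual_prob_def by (intro mult_nonneg_nonneg sum_nonneg) auto

lemma dual_prob_le_1: "dual_prob \<tau> M s k \<le> 1"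
  unfolding dual_prob_def by (intro average_le) auto

text \<open>Primes dividing every entry divide one fixed nonzero k j, so there are at most log2 |k
  j| of them. Since all factors of W and all weights are at most 1, |k j| powr \<alpha> is at most 1
  / W.\<close>

lemma dual_prob_le:
  assumes "0 < \<tau>" "\<tau> < 1" "s \<ge> 1" "M \<ge> 1" "k \<in> int_vecs s" "k \<noteq> zero_vec s" "W s k > 0"
  shows "dual_prob \<tau> M s k \<le> 4 / (\<tau> * real M) + log 2 (1 / W s k) / (\<alpha> * real (card (primes_half_upto M)))"
proof (cases "primes_half_upto M = {}")
  case True
  then show ?thesis using assms W_bounds[of s k] by (simp add: dual_prob_def)
next
  case False
  define P where "P = primes_half_upto M"
  have neP: "P \<noteq> {}" using False by (simp add: P_def)
  have cP: "card P > 0" using False finite_primes_half_upto by (simp add: P_def card_gt_0_iff)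
  define S where "S = {N \<in> P. \<forall>j\<in>{1..s}. int N dvd k j}"
  have finP: "finite P" by (simp add: P_def finite_primes_half_upto)
  have \<alpha>: "\<alpha> > 0" using q_gt q_less by linarith
  have "\<exists>j\<in>{1..s}. k j \<noteq> 0"
  proof (rule ccontr)
    assume "\<not> ?thesis"
    then have "k = zero_vec s" using assms(5) by (auto simp: fun_eq_iff zero_vec_def int_vecs_def PiE_def extensional_def)
    then show False using assms(6) by simp
  qed
  then obtain j where j: "j \<in> {1..s}" "k j \<noteq> 0" by auto
  have "2 ^ card S \<le> nat \<bar>k j\<bar>"
  proof (rule two_power_card_primes_le)
    show "prime p \<and> p dvd nat \<bar>k j\<bar>" if "p \<in> S" for p
    proof -
      have "int p dvd k j" using that j by (auto simp: S_def)
      then have "int p dvd int (nat \<bar>k j\<bar>)" by simp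
      then have "p dvd nat \<bar>k j\<bar>" by (simp only: int_dvd_int_iff)
      then show ?thesis using that primes_half_uptoD(1) by (auto simp: S_def P_def)
    qed
  qed (use j finP in \<open>auto simp: S_def\<close>)
  then have "real (2 ^ card S) \<le> real (nat \<bar>k j\<bar>)" by (simp only: of_nat_le_iff)
  then have S2: "2 ^ card S \<le> \<bar>real_of_int (k j)\<bar>" by simp
  have "real (card S) = log 2 (2 ^ card S)" by (simp add: log_nat_power)
  also have "\<dots> \<le> log 2 \<bar>real_of_int (k j)\<bar>" using S2 j by (subst log_le_cancel_iff) auto
  finally have S_le: "real (card S) \<le> log 2 \<bar>real_of_int (k j)\<bar>" .
  have "W s k = w j (k j) * (\<Prod>i\<in>{1..s} - {j}. w i (k i))"
    unfolding W_def using j by (intro prod.remove) auto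
  also have "\<dots> \<le> w j (k j) * 1"
    using j by (intro mult_left_mono prod_le_1 conjI w_bounds) auto
  also have "\<dots> \<le> 1 / \<bar>real_of_int (k j)\<bar> powr \<alpha>"
    using j weights[of j] by (auto simp: w_def intro!: divide_right_mono)
  finally have Wle: "W s k \<le> 1 / \<bar>real_of_int (k j)\<bar> powr \<alpha>" .
  then have "\<bar>real_of_int (k j)\<bar> powr \<alpha> \<le> 1 / W s k"
    using assms(7) j by (simp add: field_simps)
  then have "log 2 (\<bar>real_of_int (k j)\<bar> powr \<alpha>) \<le> log 2 (1 / W s k)"
    using assms(7) j by (subst log_le_cancel_iff) auto
  then have "\<alpha> * log 2 \<bar>real_of_int (k j)\<bar> \<le> log 2 (1 / W s k)" using j by (simp add: log_powr)
  then have "log 2 \<bar>real_of_int (k j)\<bar> \<le> log 2 (1 / W s k) / \<alpha>" using \<alpha> by (simp add: field_simps)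
  with S_le have cardS: "real (card S) \<le> log 2 (1 / W s k) / \<alpha>" by linarith
  have "dual_prob \<tau> M s k \<le> (1 / real (card P)) * (\<Sum>N\<in>P. 4 / (\<tau> * real M) + of_bool (\<forall>j\<in>{1..s}. int N dvd k j))"
    unfolding dual_prob_def P_def using assms primes_half_uptoD
    by (intro mult_left_mono sum_mono prob_dual_le) auto
  also have "\<dots> = 4 / (\<tau> * real M) + real (card S) / real (card P)"
    using neP finP by (simp add: sum.distrib sum_of_bool_eq S_def Int_def add_divide_distrib)
  also have "real (card S) / real (card P) \<le> (log 2 (1 / W s k) / \<alpha>) / real (card P)"
    using cardS by (rule divide_right_mono) simp
  finally show ?thesis by (simp add: P_def)
qed

text \<open>Interchanges the sum over k with the average over N and z. It serves both for Fourier
  coefficients, giving the error bound, and for squared reciprocal weights, giving the average of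
  R.\<close>

lemma has_sum_dual_prob:
  assumes "\<And>N z. ((\<lambda>k. f k * of_bool (k \<in> dual_lattice s N z)) has_sum F N z) A"
  shows "((\<lambda>k. f k * dual_prob \<tau> M s k) has_sum (1 / real (card (primes_half_upto M))) *
    (\<Sum>N\<in>primes_half_upto M. (1 / real (card (cbc_vectors \<alpha> \<gamma> \<tau> s N))) *
      (\<Sum>z\<in>cbc_vectors \<alpha> \<gamma> \<tau> s N. F N z))) A"
proof -
  have eq: "f k * dual_prob \<tau> M s k = (1 / real (card (primes_half_upto M))) *
      (\<Sum>N\<in>primes_half_upto M. (1 / real (card (cbc_vectors \<alpha> \<gamma> \<tau> s N))) *
        (\<Sum>z\<in>cbc_vectors \<alpha> \<gamma> \<tau> s N. f k * of_bool (k \<in> dual_lattice s N z)))" for k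
    unfolding dual_prob_def by (simp only: sum_distrib_left mult_ac)
  show ?thesis unfolding eq by (intro has_sum_cmult_right has_sum_sum assms)
qed

lemma has_sum_korobov_R:
  "((\<lambda>k. (W s k)\<^sup>2 * of_bool (k \<in> dual_lattice s N z)) has_sum korobov_R \<alpha> \<gamma> s N z) (int_vecs s - {zero_vec s})"
proof -
  have "((\<lambda>k. (W s k)\<^sup>2) has_sum korobov_R \<alpha> \<gamma> s N z) (dual_lattice s N z - {zero_vec s})"
    unfolding korobov_R_def inverse_korobov_r_sq
    by (intro has_sum_infsum summable_W_sq) (auto simp: dual_lattice_def)
  also have "?this \<longleftrightarrow> ?thesis"
    by (rule has_sum_cong_neutral) (auto simp: dual_lattice_def)
  finally show ?thesis .
qed

text \<open>With the weight B, the norm and the hypothesis on the second sum each contribute at most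
  B/2.\<close>

lemma rand_error_term_le:
  assumes f: "f \<in> korobov_space s \<alpha> \<gamma>" "korobov_norm s \<alpha> \<gamma> f \<le> 1" and B: "0 < B"
    and summ: "(\<lambda>k. (W s k)\<^sup>2 * (dual_prob \<tau> M s k)\<^sup>2) summable_on (int_vecs s - {zero_vec s})"
    and le: "(\<Sum>\<^sub>\<infinity>k\<in>int_vecs s - {zero_vec s}. (W s k)\<^sup>2 * (dual_prob \<tau> M s k)\<^sup>2) \<le> B\<^sup>2"
  shows "(1 / real (card (primes_half_upto M))) *
     (\<Sum>N\<in>primes_half_upto M. (1 / real (card (cbc_vectors \<alpha> \<gamma> \<tau> s N))) *
       (\<Sum>z\<in>cbc_vectors \<alpha> \<gamma> \<tau> s N. \<bar>lattice_rule s N z f - cube_integral s f\<bar>)) \<le> B"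
    (is "?err \<le> B")
proof -
  define A where "A = int_vecs s - {zero_vec s}"
  define c where "c = (\<lambda>k. norm (fourier_coeff s f k))"
  define p where "p = dual_prob \<tau> M s"
  define r where "r = korobov_r \<alpha> \<gamma> s"
  have c_summ: "c summable_on A"
    by (rule summable_on_subset_banach[of _ "int_vecs s"]) (use f(1) in \<open>auto simp: korobov_space_def c_def A_def\<close>)
  have F: "((\<lambda>k. c k * of_bool (k \<in> dual_lattice s N z)) has_sum
      (\<Sum>\<^sub>\<infinity>k\<in>A. c k * of_bool (k \<in> dual_lattice s N z))) A" for N z
    by (intro has_sum_infsum summable_on_comparison_test[OF c_summ]) (auto simp: c_def)
  have "?err \<le> (1 / real (card (primes_half_upto M))) *
     (\<Sum>N\<in>primes_half_upto M. (1 / real (card (cbc_vectors \<alpha> \<gamma> \<tau> s N))) *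
       (\<Sum>z\<in>cbc_vectors \<alpha> \<gamma> \<tau> s N. (\<Sum>\<^sub>\<infinity>k\<in>A. c k * of_bool (k \<in> dual_lattice s N z))))"
  proof (intro mult_left_mono sum_mono)
    fix N z assume "N \<in> primes_half_upto M"
    then have "N \<ge> 1" using primes_half_uptoD(1) prime_ge_1_nat by blast
    then show "\<bar>lattice_rule s N z f - cube_integral s f\<bar> \<le> (\<Sum>\<^sub>\<infinity>k\<in>A. c k * of_bool (k \<in> dual_lattice s N z))"
      unfolding A_def c_def using f(1) by (intro lattice_error_le)
  qed auto
  also have "\<dots> = (\<Sum>\<^sub>\<infinity>k\<in>A. c k * p k)"
    using infsumI[OF has_sum_dual_prob[OF F, where \<tau> = \<tau> and M = M]] by (simp add: p_def)
  also have "\<dots> \<le> (\<Sum>\<^sub>\<infinity>k\<in>A. B / 2 * ((r k)\<^sup>2 * (c k)\<^sup>2) + 1 / (2 * B) * ((W s k)\<^sup>2 * (p k)\<^sup>2))"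
  proof (rule infsum_mono)
    show "(\<lambda>k. c k * p k) summable_on A"
      using has_sum_imp_summable[OF has_sum_dual_prob[OF F]] by (simp add: p_def)
    have "(\<lambda>k. (r k)\<^sup>2 * (c k)\<^sup>2) summable_on A"
      by (rule summable_on_subset_banach[of _ "int_vecs s"]) (use f(1) in \<open>auto simp: korobov_space_def c_def A_def r_def\<close>)
    then show "(\<lambda>k. B / 2 * ((r k)\<^sup>2 * (c k)\<^sup>2) + 1 / (2 * B) * ((W s k)\<^sup>2 * (p k)\<^sup>2)) summable_on A"
      using summ unfolding A_def p_def by (intro summable_on_add summable_on_cmult_right)
    fix k assume k: "k \<in> A"
    show "c k * p k \<le> B / 2 * ((r k)\<^sup>2 * (c k)\<^sup>2) + 1 / (2 * B) * ((W s k)\<^sup>2 * (p k)\<^sup>2)"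
    proof (cases "W s k = 0")
      case True
      \<comment> \<open>Here \<open>korobov_r\<close> is 0 by convention and gives no control;
        instead the space forces the coefficient itself to vanish.\<close>
      then obtain j where j: "j \<in> {1..s}" "w j (k j) = 0" by (auto simp: W_def)
      then have "\<gamma> j = 0 \<and> k j \<noteq> 0" by (auto simp: w_def split: if_splits)
      then have "c k = 0" using f(1) k j by (auto simp: korobov_space_def A_def c_def)
      then show ?thesis using B by simp
    next
      case False
      have rW: "r k * W s k = 1" using inverse_korobov_r[of s k] False
        by (cases "korobov_r \<alpha> \<gamma> s k = 0") (auto simp: r_def field_simps)
      \<comment> \<open>Cauchy-Schwarz in the form of AM-GM with weight \<open>B\<close>\<close>
      have "0 \<le> (B * (r k * c k) - W s k * p k)\<^sup>2" by simp
      also have "\<dots> = B\<^sup>2 * ((r k)\<^sup>2 * (c k)\<^sup>2) + (W s k)\<^sup>2 * (p k)\<^sup>2 - 2 * B * (r k * W s k) * (c k * p k)"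
        by (simp add: power2_eq_square algebra_simps)
      finally have "2 * B * (c k * p k) \<le> B\<^sup>2 * ((r k)\<^sup>2 * (c k)\<^sup>2) + (W s k)\<^sup>2 * (p k)\<^sup>2"
        using rW by simp
      then have "c k * p k \<le> (B\<^sup>2 * ((r k)\<^sup>2 * (c k)\<^sup>2) + (W s k)\<^sup>2 * (p k)\<^sup>2) / (2 * B)"
        using B by (simp add: pos_le_divide_eq mult.commute)
      also have "\<dots> = B / 2 * ((r k)\<^sup>2 * (c k)\<^sup>2) + 1 / (2 * B) * ((W s k)\<^sup>2 * (p k)\<^sup>2)"
        using B by (simp add: power2_eq_square add_divide_distrib)
      finally show ?thesis .
    qed
  qed
  also have "\<dots> = B / 2 * (\<Sum>\<^sub>\<infinity>k\<in>A. (r k)\<^sup>2 * (c k)\<^sup>2) + 1 / (2 * B) * (\<Sum>\<^sub>\<infinity>k\<in>A. (W s k)\<^sup>2 * (p k)\<^sup>2)"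
  proof -
    have "(\<lambda>k. (r k)\<^sup>2 * (c k)\<^sup>2) summable_on A"
      by (rule summable_on_subset_banach[of _ "int_vecs s"]) (use f(1) in \<open>auto simp: korobov_space_def c_def A_def r_def\<close>)
    then have "((\<lambda>k. B / 2 * ((r k)\<^sup>2 * (c k)\<^sup>2) + 1 / (2 * B) * ((W s k)\<^sup>2 * (p k)\<^sup>2)) has_sum
      B / 2 * (\<Sum>\<^sub>\<infinity>k\<in>A. (r k)\<^sup>2 * (c k)\<^sup>2) + 1 / (2 * B) * (\<Sum>\<^sub>\<infinity>k\<in>A. (W s k)\<^sup>2 * (p k)\<^sup>2)) A"
      using summ unfolding A_def p_def by (intro has_sum_add has_sum_cmult_right has_sum_infsum)
    then show ?thesis by (rule infsumI)
  qed
  also have "\<dots> \<le> B / 2 * 1 + 1 / (2 * B) * B\<^sup>2"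
  proof (intro add_mono mult_left_mono)
    show "(\<Sum>\<^sub>\<infinity>k\<in>A. (W s k)\<^sup>2 * (p k)\<^sup>2) \<le> B\<^sup>2" using le by (simp add: A_def p_def)
    have s: "(\<lambda>k. (r k)\<^sup>2 * (c k)\<^sup>2) summable_on int_vecs s"
      using f(1) by (simp add: korobov_space_def c_def r_def)
    have "(\<Sum>\<^sub>\<infinity>k\<in>A. (r k)\<^sup>2 * (c k)\<^sup>2) \<le> (\<Sum>\<^sub>\<infinity>k\<in>int_vecs s. (r k)\<^sup>2 * (c k)\<^sup>2)"
      by (rule infsum_mono2[OF summable_on_subset_banach[OF s] s]) (auto simp: A_def)
    also have "\<dots> \<le> 1" using f(2) by (simp add: korobov_norm_def r_def c_def)
    finally show "(\<Sum>\<^sub>\<infinity>k\<in>A. (r k)\<^sup>2 * (c k)\<^sup>2) \<le> 1" .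
  qed (use B in auto)
  also have "\<dots> = B" using B by (simp add: power2_eq_square)
  finally show ?thesis .
qed

text \<open>One factor P(k) is estimated individually, the other is kept to form the average of R.
  Very small W s k, where the individual estimate is useless, are handled with P(k) <= 1.\<close>

lemma sum_sq_dual_prob_le:
  assumes \<tau>: "0 < \<tau>" "\<tau> < 1" and C: "\<And>s. T s \<le> C"
    and c: "0 < c" "\<And>M. primes_half_upto M \<noteq> {} \<Longrightarrow> c * real M powr (1 - \<epsilon>) \<le> real (card (primes_half_upto M))"
    and \<epsilon>: "0 < \<epsilon>"
  obtains D where "0 < D" and
    "\<And>M s. M \<ge> 2 \<Longrightarrow> s \<ge> 1 \<Longrightarrow> primes_half_upto M \<noteq> {} \<Longrightarrow>
      (\<lambda>k. (W s k)\<^sup>2 * (dual_prob \<tau> M s k)\<^sup>2) summable_on (int_vecs s - {zero_vec s}) \<and>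
      (\<Sum>\<^sub>\<infinity>k\<in>int_vecs s - {zero_vec s}. (W s k)\<^sup>2 * (dual_prob \<tau> M s k)\<^sup>2) \<le> D * real M powr (- 2 * q - 1 + 2 * \<epsilon>)"
proof -
  \<comment> \<open>so that \<open>(W s k)\<^sup>2 \<le> M powr (- 2 * q - 1) * W s k powr (1 / q)\<close> whenever \<open>W s k < M powr - a\<close>\<close>
  define a where "a = (2 * q + 1) / (2 - 1 / q)"
  have q2: "2 - 1 / q > 0" using q_gt by (simp add: field_simps)
  have a: "a > 0" "a * (2 - 1 / q) = 2 * q + 1" using q2 q_gt by (auto simp: a_def)
  have \<alpha>: "\<alpha> > 0" using q_gt q_less by linarith
  have ln2: "ln (2 :: real) > 0" by simp
  \<comment> \<open>The first summand comes from the random z. The second comes from the primes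
    dividing k, with ln x <= x powr \<epsilon> / \<epsilon> and at least c x powr (1 - \<epsilon>)
    available primes.\<close>
  define C1 where "C1 = 4 / \<tau> + a / (\<epsilon> * ln 2 * \<alpha> * c)"
  \<comment> \<open>The 8 is the 2 of \<open>korobov_R_cbc_le\<close> times the 4 from N - 1 >=
    M/4.\<close>
  define C2 where "C2 = (8 / (1 - \<tau>) * C) powr (2 * q)"
  have C1: "C1 > 0" unfolding C1_def using \<tau> a \<alpha> c \<epsilon> by (intro add_pos_pos divide_pos_pos mult_pos_pos) auto
  have C0: "C > 0" using C[of 0] T_ge_1[of 0] by linarith
  show thesis
  proof (rule that[of "C1 * C2 + C"])
    show "0 < C1 * C2 + C" using C1 C0 by (intro add_nonneg_pos mult_nonneg_nonneg) (auto simp: C2_def)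
    fix M s :: nat
    assume M: "M \<ge> 2" and s: "s \<ge> 1" and ne: "primes_half_upto M \<noteq> {}"
    define x where "x = real M"
    have x: "x \<ge> 2" using M by (simp add: x_def)
    define p where "p = dual_prob \<tau> M s"
    have p: "0 \<le> p k" "p k \<le> 1" for k by (simp_all add: p_def dual_prob_nonneg dual_prob_le_1)
    define A where "A = int_vecs s - {zero_vec s}"
    define R where "R = (1 / real (card (primes_half_upto M))) *
      (\<Sum>N\<in>primes_half_upto M. (1 / real (card (cbc_vectors \<alpha> \<gamma> \<tau> s N))) *
        (\<Sum>z\<in>cbc_vectors \<alpha> \<gamma> \<tau> s N. korobov_R \<alpha> \<gamma> s N z))"
    have cP: "c * x powr (1 - \<epsilon>) \<le> real (card (primes_half_upto M))" unfolding x_def using ne by (rule c(2))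
    have p_le: "p k \<le> C1 * x powr (- 1 + 2 * \<epsilon>)" if k: "k \<in> A" "x powr - a \<le> W s k" for k
    proof -
      have W0: "W s k > 0" using k(2) x by (smt (verit) powr_gt_zero)
      have "1 / W s k \<le> x powr a" using k(2) W0 x by (simp add: powr_minus field_simps)
      then have "log 2 (1 / W s k) \<le> log 2 (x powr a)" using W0 x by (subst log_le_cancel_iff) auto
      also have "\<dots> = a * (ln x / ln 2)" using x by (simp add: log_powr log_def)
      also have "\<dots> \<le> a * ((x powr \<epsilon> / \<epsilon>) / ln 2)"
        using a x \<epsilon> by (intro mult_left_mono divide_right_mono ln_powr_bound) auto
      finally have "log 2 (1 / W s k) / (\<alpha> * real (card (primes_half_upto M))) \<le>
          a * ((x powr \<epsilon> / \<epsilon>) / ln 2) / (\<alpha> * (c * x powr (1 - \<epsilon>)))"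
        using cP \<alpha> c(1) x a \<epsilon> by (intro frac_le mult_left_mono mult_pos_pos) auto
      also have "\<dots> = a / (\<epsilon> * ln 2 * \<alpha> * c) * (x powr \<epsilon> / x powr (1 - \<epsilon>))" by simp
      also have "x powr \<epsilon> / x powr (1 - \<epsilon>) = x powr (- 1 + 2 * \<epsilon>)" by (simp flip: powr_diff)
      finally have log_le: "log 2 (1 / W s k) / (\<alpha> * real (card (primes_half_upto M))) \<le>
          a / (\<epsilon> * ln 2 * \<alpha> * c) * x powr (- 1 + 2 * \<epsilon>)" .
      have "x powr - 1 \<le> x powr (- 1 + 2 * \<epsilon>)" using x \<epsilon> by (intro powr_mono) auto
      then have "4 / \<tau> * x powr - 1 \<le> 4 / \<tau> * x powr (- 1 + 2 * \<epsilon>)" using \<tau> by (intro mult_left_mono) auto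
      moreover have "4 / (\<tau> * x) = 4 / \<tau> * x powr - 1" using x by (simp add: powr_minus divide_simps)
      moreover have "p k \<le> 4 / (\<tau> * x) + log 2 (1 / W s k) / (\<alpha> * real (card (primes_half_upto M)))"
        unfolding p_def x_def using \<tau> s M k W0 by (intro dual_prob_le) (auto simp: A_def)
      ultimately show ?thesis using log_le unfolding C1_def distrib_right by linarith
    qed
    \<comment> \<open>One majorant for both ranges: the first term covers W s k >= x powr - a and
      sums to a multiple of R, the second covers smaller W s k and sums to at most a multiple of T
      s.\<close>
    define U where "U = (\<lambda>k. C1 * x powr (- 1 + 2 * \<epsilon>) * ((W s k)\<^sup>2 * p k) + x powr (- 2 * q - 1) * W s k powr (1 / q))"
    have le_U: "(W s k)\<^sup>2 * (p k)\<^sup>2 \<le> U k" if k: "k \<in> A" for k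
    proof (cases "x powr - a \<le> W s k")
      case True
      have "(W s k)\<^sup>2 * (p k)\<^sup>2 = ((W s k)\<^sup>2 * p k) * p k" by (simp add: power2_eq_square)
      also have "\<dots> \<le> ((W s k)\<^sup>2 * p k) * (C1 * x powr (- 1 + 2 * \<epsilon>))"
        using p k True by (intro mult_left_mono p_le) auto
      also have "\<dots> \<le> U k" by (simp add: U_def)
      finally show ?thesis .
    next
      case False
      have "(W s k)\<^sup>2 * (p k)\<^sup>2 \<le> (W s k)\<^sup>2 * 1" using p[of k] by (intro mult_left_mono power_le_one) auto
      also have "(W s k)\<^sup>2 * 1 \<le> x powr (- 2 * q - 1) * W s k powr (1 / q)"
      proof (cases "W s k = 0")
        case W: False
        then have eq: "(W s k)\<^sup>2 * 1 = W s k powr (2 - 1 / q) * W s k powr (1 / q)"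
          using W_bounds[of s k] by (simp flip: powr_add)
        have "W s k powr (2 - 1 / q) \<le> (x powr - a) powr (2 - 1 / q)"
          using False W_bounds[of s k] q2 by (intro powr_mono2) auto
        also have "(x powr - a) powr (2 - 1 / q) = x powr (- 2 * q - 1)"
          using a(2) by (simp add: powr_powr)
        finally show ?thesis unfolding eq by (rule mult_right_mono) simp
      qed simp
      also have "\<dots> \<le> U k" using C1 p[of k] by (simp add: U_def)
      finally show ?thesis .
    qed
    have hR: "((\<lambda>k. (W s k)\<^sup>2 * p k) has_sum R) A"
      unfolding R_def p_def A_def by (intro has_sum_dual_prob has_sum_korobov_R)
    have W_summ: "(\<lambda>k. W s k powr (1 / q)) summable_on A" by (rule summable_W_powr) (auto simp: A_def)
    define V where "V = (\<Sum>\<^sub>\<infinity>k\<in>A. W s k powr (1 / q))"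
    have hU: "(U has_sum (C1 * x powr (- 1 + 2 * \<epsilon>) * R + x powr (- 2 * q - 1) * V)) A"
      unfolding U_def V_def by (intro has_sum_add has_sum_cmult_right hR has_sum_infsum W_summ)
    have summ: "(\<lambda>k. (W s k)\<^sup>2 * (p k)\<^sup>2) summable_on A"
      by (rule summable_on_comparison_test[OF has_sum_imp_summable[OF hU]]) (use le_U in auto)
    have "V \<le> (\<Sum>\<^sub>\<infinity>k\<in>int_vecs s. W s k powr (1 / q))"
      unfolding V_def by (intro infsum_mono2 W_summ summable_W_powr) (auto simp: A_def)
    also have "\<dots> = T s" by (rule infsumI[OF has_sum_W])
    finally have V: "V \<le> C" using C[of s] by linarith
    have R: "R \<le> C2 * x powr (- 2 * q)"
      unfolding R_def
    proof (intro average_le)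
      fix N z assume N: "N \<in> primes_half_upto M" and z: "z \<in> cbc_vectors \<alpha> \<gamma> \<tau> s N"
      have N2: "N \<ge> 2" "x / 2 \<le> real N"
        using primes_half_uptoD[OF N] prime_ge_2_nat by (auto simp: x_def)
      have "x / 4 \<le> real (N - 1)" using N2 by (simp add: of_nat_diff)
      then have "2 / ((1 - \<tau>) * real (N - 1)) * T s \<le> 2 / ((1 - \<tau>) * (x / 4)) * C"
        using \<tau> x C[of s] T_ge_1[of s] by (intro mult_mono divide_left_mono mult_left_mono mult_pos_pos) auto
      also have "\<dots> = 8 / (1 - \<tau>) * C * x powr - 1" using x by (simp add: powr_minus divide_simps)
      finally have le: "2 / ((1 - \<tau>) * real (N - 1)) * T s \<le> 8 / (1 - \<tau>) * C * x powr - 1" .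
      have "korobov_R \<alpha> \<gamma> s N z \<le> (2 / ((1 - \<tau>) * real (N - 1)) * T s) powr (2 * q)"
        using primes_half_uptoD(1)[OF N] \<tau> z by (rule korobov_R_cbc_le)
      also have "\<dots> \<le> (8 / (1 - \<tau>) * C * x powr - 1) powr (2 * q)"
        using le q_gt \<tau> T_ge_1[of s] by (intro powr_mono2 mult_nonneg_nonneg divide_nonneg_nonneg) auto
      also have "\<dots> = C2 * (x powr - 1) powr (2 * q)"
        unfolding C2_def by (rule powr_mult)
      also have "(x powr - 1) powr (2 * q) = x powr (- 2 * q)" unfolding powr_powr by simp
      finally show "korobov_R \<alpha> \<gamma> s N z \<le> C2 * x powr (- 2 * q)" .
    qed (auto simp: C2_def)
    have "(\<Sum>\<^sub>\<infinity>k\<in>A. (W s k)\<^sup>2 * (p k)\<^sup>2) \<le> infsum U A"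
      using summ has_sum_imp_summable[OF hU] le_U by (rule infsum_mono)
    also have "\<dots> = C1 * x powr (- 1 + 2 * \<epsilon>) * R + x powr (- 2 * q - 1) * V" by (rule infsumI[OF hU])
    also have "\<dots> \<le> C1 * x powr (- 1 + 2 * \<epsilon>) * (C2 * x powr (- 2 * q)) + x powr (- 2 * q - 1 + 2 * \<epsilon>) * C"
      using R V C1 x \<epsilon> by (intro add_mono mult_left_mono mult_mono powr_mono) (auto simp: V_def intro: infsum_nonneg)
    also have "x powr (- 1 + 2 * \<epsilon>) * (x powr (- 2 * q)) = x powr (- 2 * q - 1 + 2 * \<epsilon>)"
      unfolding powr_add[symmetric] by (rule arg_cong[where f = "\<lambda>e. x powr e"]) simp
    then have "C1 * x powr (- 1 + 2 * \<epsilon>) * (C2 * x powr (- 2 * q)) + x powr (- 2 * q - 1 + 2 * \<epsilon>) * C =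
        (C1 * C2 + C) * x powr (- 2 * q - 1 + 2 * \<epsilon>)" by (simp add: algebra_simps)
    finally have "(\<Sum>\<^sub>\<infinity>k\<in>A. (W s k)\<^sup>2 * (p k)\<^sup>2) \<le> (C1 * C2 + C) * x powr (- 2 * q - 1 + 2 * \<epsilon>)" .
    then show "(\<lambda>k. (W s k)\<^sup>2 * (dual_prob \<tau> M s k)\<^sup>2) summable_on (int_vecs s - {zero_vec s}) \<and>
      (\<Sum>\<^sub>\<infinity>k\<in>int_vecs s - {zero_vec s}. (W s k)\<^sup>2 * (dual_prob \<tau> M s k)\<^sup>2) \<le> (C1 * C2 + C) * real M powr (- 2 * q - 1 + 2 * \<epsilon>)"
      using summ by (simp add: A_def p_def x_def)
  qed
qed

lemma rand_error_le:
  assumes summ: "summable (\<lambda>j. \<gamma> (Suc j) powr (1 / q))" and \<tau>: "0 < \<tau>" "\<tau> < 1" and \<delta>: "0 < \<delta>"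
  shows "\<exists>C>0. \<forall>M s. M \<ge> 2 \<and> s \<ge> 1 \<longrightarrow>
    rand_error \<alpha> \<gamma> \<tau> s M \<le> ereal (C * real M powr (- (q + 1/2 - \<delta>)))"
proof -
  \<comment> \<open>The prime count needs \<epsilon> < 1, while \<delta> may be arbitrarily
    large.\<close>
  define \<epsilon> where "\<epsilon> = min \<delta> (1/2)"
  have \<epsilon>: "0 < \<epsilon>" "\<epsilon> < 1" "\<epsilon> \<le> \<delta>" using \<delta> by (auto simp: \<epsilon>_def)
  obtain C where C: "\<And>s. T s \<le> C" using T_bounded[OF summ] by auto
  obtain c where c: "0 < c" "\<And>M. primes_half_upto M \<noteq> {} \<Longrightarrow> c * real M powr (1 - \<epsilon>) \<le> real (card (primes_half_upto M))"
    using card_primes_half_upto_ge[OF \<epsilon>(1,2)] by auto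
  obtain D where D: "0 < D" "\<And>M s. M \<ge> 2 \<Longrightarrow> s \<ge> 1 \<Longrightarrow> primes_half_upto M \<noteq> {} \<Longrightarrow>
      (\<lambda>k. (W s k)\<^sup>2 * (dual_prob \<tau> M s k)\<^sup>2) summable_on (int_vecs s - {zero_vec s}) \<and>
      (\<Sum>\<^sub>\<infinity>k\<in>int_vecs s - {zero_vec s}. (W s k)\<^sup>2 * (dual_prob \<tau> M s k)\<^sup>2) \<le> D * real M powr (- 2 * q - 1 + 2 * \<epsilon>)"
    by (rule sum_sq_dual_prob_le[OF \<tau> C c \<epsilon>(1)]) (assumption, rule that)
  show ?thesis
  proof (intro exI[of _ "sqrt D"] conjI allI impI)
    show "sqrt D > 0" using D(1) by simp
    fix M s :: nat assume Ms: "M \<ge> 2 \<and> s \<ge> 1"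
    define e where "e = - (q + 1/2 - \<delta>)"
    \<comment> \<open>The square root of the bound for the sum of squares, which halves the loss 2
      \<epsilon>.\<close>
    define B where "B = sqrt D * real M powr (- q - 1/2 + \<epsilon>)"
    have B0: "B > 0" using D(1) Ms by (simp add: B_def)
    have "(real M powr (- q - 1/2 + \<epsilon>))\<^sup>2 = real M powr (- 2 * q - 1 + 2 * \<epsilon>)"
      unfolding power2_eq_square powr_add[symmetric] by (rule arg_cong[where f = "\<lambda>e. real M powr e"]) simp
    then have B2: "B\<^sup>2 = D * real M powr (- 2 * q - 1 + 2 * \<epsilon>)"
      using D(1) by (simp add: B_def power_mult_distrib)
    have "B \<le> sqrt D * real M powr e"
      unfolding B_def e_def using D(1) Ms \<epsilon> by (intro mult_left_mono powr_mono) auto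
    moreover have "(1 / real (card (primes_half_upto M))) *
       (\<Sum>N\<in>primes_half_upto M. (1 / real (card (cbc_vectors \<alpha> \<gamma> \<tau> s N))) *
         (\<Sum>z\<in>cbc_vectors \<alpha> \<gamma> \<tau> s N. \<bar>lattice_rule s N z f - cube_integral s f\<bar>)) \<le> B"
      if "f \<in> {f \<in> korobov_space s \<alpha> \<gamma>. korobov_norm s \<alpha> \<gamma> f \<le> 1}" for f
    proof (cases "primes_half_upto M = {}")
      \<comment> \<open>Without primes the average is 0 by division by zero.\<close>
      case True
      then show ?thesis using B0 by simp
    next
      case False
      then show ?thesis using D(2)[of M s] that Ms B0 unfolding B2[symmetric]
        by (intro rand_error_term_le) auto
    qed
    ultimately show "rand_error \<alpha> \<gamma> \<tau> s M \<le> ereal (sqrt D * real M powr (- (q + 1/2 - \<delta>)))"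
      unfolding rand_error_def e_def by (intro SUP_least) (auto intro: order_trans)
  qed
qed

end

section \<open>Rates for exponents below \<alpha> and passage to \<alpha>\<close>

theorem mainTheorem2:
  fixes \<alpha> \<tau> :: real and \<gamma> :: "nat \<Rightarrow> real"
  assumes "\<alpha> > 1/2"
    and "\<And>j. j \<ge> 1 \<Longrightarrow> 0 \<le> \<gamma> j \<and> \<gamma> j \<le> 1"
    and "0 < \<tau>" "\<tau> < 1"
  shows "(\<forall>q. 1/2 < q \<longrightarrow> q < \<alpha> \<longrightarrow> summable (\<lambda>j. \<gamma> (Suc j) powr (1 / q)) \<longrightarrow>
            (\<forall>\<delta>. 0 < \<delta> \<longrightarrow> \<delta> < min (q - 1/2) 1 \<longrightarrow>
              (\<exists>C>0. \<forall>M s. admissible \<alpha> \<gamma> \<tau> M s \<longrightarrow>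
                 rand_error \<alpha> \<gamma> \<tau> s M \<le> ereal (C * real M powr (- (q + 1/2 - \<delta>))))))
       \<and> (summable (\<lambda>j. \<gamma> (Suc j) powr (1 / \<alpha>)) \<longrightarrow>
            (\<forall>\<epsilon>>0. \<exists>C>0. \<forall>M s. admissible \<alpha> \<gamma> \<tau> M s \<longrightarrow>
                 rand_error \<alpha> \<gamma> \<tau> s M \<le> ereal (C * real M powr (- (\<alpha> + 1/2) + \<epsilon>))))"
proof -
  have bound: "\<exists>C>0. \<forall>M s. admissible \<alpha> \<gamma> \<tau> M s \<longrightarrow>
      rand_error \<alpha> \<gamma> \<tau> s M \<le> ereal (C * real M powr (- (q + 1/2 - \<delta>)))"
    if q: "1/2 < q" "q < \<alpha>" "summable (\<lambda>j. \<gamma> (Suc j) powr (1 / q))" and \<delta>: "0 < \<delta>" for q \<delta>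
  proof -
    interpret korobov_weights \<alpha> q \<gamma> using q assms by unfold_locales auto
    obtain C where "C > 0" "\<And>M s. M \<ge> 2 \<and> s \<ge> 1 \<Longrightarrow>
        rand_error \<alpha> \<gamma> \<tau> s M \<le> ereal (C * real M powr (- (q + 1/2 - \<delta>)))"
      using rand_error_le[OF q(3) assms(3,4) \<delta>] by auto
    then show ?thesis unfolding admissible_def by auto
  qed
  have "\<exists>C>0. \<forall>M s. admissible \<alpha> \<gamma> \<tau> M s \<longrightarrow>
      rand_error \<alpha> \<gamma> \<tau> s M \<le> ereal (C * real M powr (- (\<alpha> + 1/2) + \<epsilon>))"
    if summ: "summable (\<lambda>j. \<gamma> (Suc j) powr (1 / \<alpha>))" and \<epsilon>: "\<epsilon> > 0" for \<epsilon>
  proof -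
    \<comment> \<open>The loss \<epsilon> is split: \<eta> is spent on lowering \<alpha> to q, and
      \<epsilon> - \<eta> > 0 serves as \<delta>. The second bound keeps q above 1/2.\<close>
    define \<eta> where "\<eta> = min (\<epsilon> / 2) ((\<alpha> - 1/2) / 2)"
    have \<eta>: "0 < \<eta>" "\<eta> \<le> \<epsilon> / 2" "\<eta> \<le> (\<alpha> - 1/2) / 2" using \<epsilon> assms(1)
      unfolding \<eta>_def by (simp, intro min.cobounded1, intro min.cobounded2)
    define q where "q = \<alpha> - \<eta>"
    have q: "1/2 < q" "q < \<alpha>" using \<eta>(1,3) assms(1) by (simp_all add: q_def field_simps)
    \<comment> \<open>As the weights are at most 1, the larger exponent 1/q gives smaller
      terms.\<close>
    have "\<gamma> (Suc j) powr (1 / q) \<le> \<gamma> (Suc j) powr (1 / \<alpha>)" for j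
    proof -
      have "1 / \<alpha> \<le> 1 / q" using q by (intro divide_left_mono mult_pos_pos) auto
      then show ?thesis using assms(2)[of "Suc j"] by (intro powr_mono') auto
    qed
    then have summ_q: "summable (\<lambda>j. \<gamma> (Suc j) powr (1 / q))"
      by (intro summable_comparison_test[OF _ summ]) (auto intro!: exI[of _ 0])
    have eq: "- (q + 1/2 - (\<epsilon> - \<eta>)) = - (\<alpha> + 1/2) + \<epsilon>" by (simp add: q_def)
    have "0 < \<epsilon> - \<eta>" using \<eta>(2) \<epsilon> by simp
    from bound[OF q summ_q this] show ?thesis unfolding eq .
  qed
  with bound show ?thesis by blast
qed

end
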